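(* Let $0<\alpha<1$, $0<\theta<1$, $\Lambda>1$ and $I=[(1-\theta)/\Lambda,\,1-\theta/\Lambda]$. Let $\Psi:I\to I$ be defined by $$\Psi(v_0)=P\left(\frac1\Lambda\left[1-\theta-c(v_0)(1-\Lambda)\int_0^{R(v_0)}e^{-c(v_0)s}v(v_0;s)\,ds\right]\right).$$ Then $\Psi$ has a fixed point $v_0^*\in I$ which solves the integro-differential system: $(c,R,v)=(c(v_0^* ),R(v_0^* ),v(v_0^*;\cdot))$, with $v(0)=v_0^*$, satisfies $$\begin{cases}\Lambda v''-cv'=v^\alpha,\quad 0<\xi<R,\\ 0<v(0)<1,\quad v'(0)=-\dfrac{c}{\Lambda}(1-v(0)),\\ v(R)=v'(R)=0,\end{cases}$$ together with $$\theta+v(0)=1-(1-\Lambda)\int_0^R e^{-cs}v'(s)\,ds.$$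
   Context: For $v_0\in(0,1)$, $(c(v_0),R(v_0),v(v_0;\xi))$ denotes the unique solution, with $c>0$, $0<R<+\infty$, $v\ge0$, $v\in C^\infty([0,R))\cap C^1([0,R])$, of the free boundary problem $\Lambda v''-cv'=v^\alpha$ on $(0,R)$, $v(0)=v_0$, $v'(0)=-\frac{c}{\Lambda}(1-v_0)$, $v(R)=v'(R)=0$. For $I=[a,b]$, $P:\mathbb{R}\to I$ is the projection $P(x)=x$ if $a<x<b$, $P(x)=a$ if $x\le a$, $P(x)=b$ if $x\ge b$. *)

theory Defs
  imports "HOL-Analysis.Analysis"
begin

text \<open>Derivatives are taken within \<open>S\<close>, hence one-sided at end points of an interval belonging to \<open>S\<close>.\<close>

definition C1_within :: "real set \<Rightarrow> (real \<Rightarrow> real) \<Rightarrow> bool" where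
  "C1_within S f \<longleftrightarrow>
     (\<exists>f'. (\<forall>x\<in>S. (f has_real_derivative f' x) (at x within S)) \<and> continuous_on S f')"

definition Cinfty_within :: "real set \<Rightarrow> (real \<Rightarrow> real) \<Rightarrow> bool" where
  "Cinfty_within S f \<longleftrightarrow>
     (\<exists>D :: nat \<Rightarrow> real \<Rightarrow> real. D 0 = f \<and>
        (\<forall>n. \<forall>x\<in>S. (D n has_real_derivative D (Suc n) x) (at x within S)))"

text \<open>The equation is imposed only in the open interval, where \<^const>\<open>deriv\<close> is the ordinary
  derivative; the boundary derivatives are one-sided.  Only the values of \<open>v\<close> on \<open>{0..R}\<close> matter.
  Smoothness up to but excluding \<open>R\<close> cannot be dropped: it keeps \<open>v\<close> from vanishing before \<open>R\<close>,
  and without it \<open>R\<close> could be enlarged arbitrarily by extending \<open>v\<close> by zero.\<close>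

definition fb_solution :: "real \<Rightarrow> real \<Rightarrow> real \<Rightarrow> real \<Rightarrow> real \<Rightarrow> (real \<Rightarrow> real) \<Rightarrow> bool" where
  "fb_solution \<alpha> \<Lambda> v0 c R v \<longleftrightarrow>
     c > 0 \<and> R > 0 \<and>
     (\<forall>\<xi>\<in>{0..R}. v \<xi> \<ge> 0) \<and>
     Cinfty_within {0..<R} v \<and> C1_within {0..R} v \<and>
     (\<forall>\<xi>\<in>{0<..<R}. \<Lambda> * deriv (deriv v) \<xi> - c * deriv v \<xi> = v \<xi> powr \<alpha>) \<and>
     v 0 = v0 \<and>
     (v has_real_derivative - (c / \<Lambda>) * (1 - v0)) (at 0 within {0..R}) \<and>
     v R = 0 \<and>
     (v has_real_derivative 0) (at R within {0..R})"

text \<open>A function on \<open>[0,R]\<close> is represented by its extensional extension to the real line, so that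
  uniqueness of \<open>v\<close> as a function on \<open>[0,R]\<close> is uniqueness of the HOL function.\<close>

definition fb_triple :: "real \<Rightarrow> real \<Rightarrow> real \<Rightarrow> real \<times> real \<times> (real \<Rightarrow> real)" where
  "fb_triple \<alpha> \<Lambda> v0 =
     (THE (c, R, v). fb_solution \<alpha> \<Lambda> v0 c R v \<and> v \<in> extensional {0..R})"

definition fb_c :: "real \<Rightarrow> real \<Rightarrow> real \<Rightarrow> real" where
  "fb_c \<alpha> \<Lambda> v0 = fst (fb_triple \<alpha> \<Lambda> v0)"

definition fb_R :: "real \<Rightarrow> real \<Rightarrow> real \<Rightarrow> real" where
  "fb_R \<alpha> \<Lambda> v0 = fst (snd (fb_triple \<alpha> \<Lambda> v0))"

definition fb_v :: "real \<Rightarrow> real \<Rightarrow> real \<Rightarrow> real \<Rightarrow> real" where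
  "fb_v \<alpha> \<Lambda> v0 = snd (snd (fb_triple \<alpha> \<Lambda> v0))"

definition proj_interval :: "real \<Rightarrow> real \<Rightarrow> real \<Rightarrow> real" where
  "proj_interval a b x = (if a < x \<and> x < b then x else if x \<le> a then a else b)"

definition Psi :: "real \<Rightarrow> real \<Rightarrow> real \<Rightarrow> real \<Rightarrow> real" where
  "Psi \<alpha> \<theta> \<Lambda> v0 =
     proj_interval ((1 - \<theta>) / \<Lambda>) (1 - \<theta> / \<Lambda>)
       (1 / \<Lambda> * (1 - \<theta> - fb_c \<alpha> \<Lambda> v0 * (1 - \<Lambda>) *
          integral {0..fb_R \<alpha> \<Lambda> v0} (\<lambda>s. exp (- fb_c \<alpha> \<Lambda> v0 * s) * fb_v \<alpha> \<Lambda> v0 s)))"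

text \<open>In the integral, \<^term>\<open>deriv v\<close> may be junk at the two end points, which form a null set.\<close>

definition integro_differential_system ::
    "real \<Rightarrow> real \<Rightarrow> real \<Rightarrow> real \<Rightarrow> real \<Rightarrow> (real \<Rightarrow> real) \<Rightarrow> bool" where
  "integro_differential_system \<alpha> \<theta> \<Lambda> c R v \<longleftrightarrow>
     0 < v 0 \<and> v 0 < 1 \<and>
     fb_solution \<alpha> \<Lambda> (v 0) c R v \<and>
     \<theta> + v 0 = 1 - (1 - \<Lambda>) * integral {0..R} (\<lambda>s. exp (- c * s) * deriv v s)"

end

theory Submission
  imports Defs "HOL-Real_Asymp.Real_Asymp"
begin

text \<open>All solutions of the free boundary problem are rescalings of a single profile: reversing the
  direction and rescaling turns the equation into \<open>w'' + w' = w powr \<alpha>\<close>, \<open>w 0 = w' 0 = 0\<close>, whose solution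
  positive on \<open>(0, \<infinity>)\<close> is unique, and \<open>v \<xi> = A w (c (R - \<xi>) / \<Lambda>)\<close> with \<open>A\<close> determined by \<open>c\<close>. With
  \<open>T = c R / \<Lambda>\<close> the boundary conditions at \<open>0\<close> read \<open>A w T = v 0\<close> and \<open>A w' T = 1 - v 0\<close>. Since \<open>w' / w\<close>
  decreases strictly from \<open>\<infinity>\<close> to \<open>0\<close>, each \<open>v 0\<close> in \<open>(0, 1)\<close> belongs to exactly one \<open>T\<close>, and everything
  depends continuously on \<open>T\<close>. The fixed point comes from the intermediate value theorem in \<open>T\<close>,
  because \<open>0 \<le> c \<integral> exp (- c s) v s ds \<le> 1\<close>; integration by parts gives the integral condition.\<close>

section \<open>Monotone iteration for the profile equation\<close>

text \<open>Since \<alpha> < 1, the power is not Lipschitz at \<open>0\<close>: besides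
  \<open>w\<close>, the zero function and every delayed copy of \<open>w\<close> start from rest.
  Picard-Lindelof thus gives neither existence nor uniqueness, and order replaces it:
  \<open>picard \<alpha>\<close> is monotone, and solutions are compared up to a first contact. The
  exponent \<open>m = 2 / (1 - \<alpha>)\<close> satisfies \<open>m * \<alpha> = m - 2\<close>, so
  powers \<open>t powr m\<close> are reproduced by two integrations. It governs the vanishing of the
  profile at \<open>0\<close>, which decides the positivity of \<open>v\<close> before
  \<open>R\<close>, and the polynomial bound on its growth, which drives \<open>w' / w\<close> to
  \<open>0\<close>. With \<open>T\<close> as parameter, speed, length and front have explicit
  formulas, so continuity of the inverse map from \<open>v 0\<close> to \<open>T\<close> is never
  asked for. The bounds on the integral term also put the argument of the projection inside
  \<open>I\<close>, so that it suffices to solve the equation without the projection.\<close>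

lemma nondecreasing_from_derivative:
  fixes f f' :: "real \<Rightarrow> real"
  assumes "a \<le> b" and "continuous_on {a..b} f"
    and "\<And>x. a < x \<Longrightarrow> x < b \<Longrightarrow> (f has_real_derivative f' x) (at x)"
    and "\<And>x. a < x \<Longrightarrow> x < b \<Longrightarrow> 0 \<le> f' x"
  shows "f a \<le> f b"
proof (cases "a = b")
  case False
  then show ?thesis
    using DERIV_nonneg_imp_increasing_open[of a b f] assms by fastforce
qed simp

lemma integral_from_0_has_derivative:
  fixes g :: "real \<Rightarrow> real"
  assumes "continuous_on {0..} g" and "0 < t"
  shows "((\<lambda>x. integral {0..x} g) has_real_derivative g t) (at t)"
proof -
  have "continuous_on {0..t + 1} g"
    using assms(1) by (rule continuous_on_subset) auto
  then have "((\<lambda>x. integral {0..x} g) has_real_derivative g t) (at t within {0..t + 1})"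
    by (rule integral_has_real_derivative) (use assms in auto)
  moreover have "at t within {0..t + 1} = at t"
    using assms by (intro at_within_interior) auto
  ultimately show ?thesis by simp
qed

lemma continuous_on_half_line:
  fixes f :: "real \<Rightarrow> real"
  assumes "\<And>b. 0 \<le> b \<Longrightarrow> continuous_on {0..b} f"
  shows "continuous_on {0..} f"
proof -
  have "continuous (at x within {0..}) f" if "0 \<le> x" for x
  proof -
    have "continuous (at x within {0..x + 1}) f"
      using assms[of "x + 1"] that by (simp add: continuous_on_eq_continuous_within)
    moreover have "at x within {0..x + 1} = at x within {0..}"
      using that by (intro at_within_nhd[of x "{..<x + 1}"]) auto
    ultimately show ?thesis by simp
  qed
  then show ?thesis by (simp add: continuous_on_eq_continuous_within)
qed

lemma integral_from_0_continuous:
  fixes g :: "real \<Rightarrow> real"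
  assumes "\<And>t. 0 \<le> t \<Longrightarrow> g integrable_on {0..t}"
  shows "continuous_on {0..} (\<lambda>x. integral {0..x} g)"
  by (intro continuous_on_half_line indefinite_integral_continuous_1 assms)

lemma continuous_on_powr_nonneg:
  fixes f :: "real \<Rightarrow> real"
  assumes "continuous_on S f" "\<And>x. x \<in> S \<Longrightarrow> 0 \<le> f x" "0 < p"
  shows "continuous_on S (\<lambda>x. f x powr p)"
  using assms by (intro continuous_on_powr') auto

text \<open>Fixed points of \<open>picard \<alpha>\<close> are the solutions of \<open>f'' + f' = f powr \<alpha>\<close>, \<open>f 0 = f' 0 = 0\<close>; the
  zero function is one of them, which is why the iteration has to start from a positive subsolution.\<close>

definition picard :: "real \<Rightarrow> (real \<Rightarrow> real) \<Rightarrow> real \<Rightarrow> real" where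
  "picard \<alpha> f t = integral {0..t} (\<lambda>s. (1 - exp (s - t)) * f s powr \<alpha>)"

text \<open>The integrand of \<open>picard\<close> depends on \<open>t\<close>; the splitting leaves
  integrals with fixed integrands, to which the fundamental theorem of calculus applies.\<close>

lemma picard_eq:
  assumes "(\<lambda>s. f s powr \<alpha>) integrable_on {0..t}"
    and "(\<lambda>s. exp s * f s powr \<alpha>) integrable_on {0..t}"
  shows "picard \<alpha> f t = integral {0..t} (\<lambda>s. f s powr \<alpha>)
    - exp (- t) * integral {0..t} (\<lambda>s. exp s * f s powr \<alpha>)"
proof -
  have "picard \<alpha> f t
      = integral {0..t} (\<lambda>s. f s powr \<alpha> - exp (- t) * (exp s * f s powr \<alpha>))"
    unfolding picard_def by (simp add: algebra_simps exp_diff exp_minus divide_inverse)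
  also have "\<dots> = integral {0..t} (\<lambda>s. f s powr \<alpha>)
      - integral {0..t} (\<lambda>s. exp (- t) * (exp s * f s powr \<alpha>))"
    by (intro integral_diff assms integrable_on_mult_right)
  finally show ?thesis by simp
qed

context
  fixes \<alpha> :: real
  assumes alpha: "0 < \<alpha>" "\<alpha> < 1"
begin

lemma powr_integrable:
  assumes "continuous_on {0..} f" "\<And>x. 0 \<le> x \<Longrightarrow> 0 \<le> f x"
  shows "continuous_on {0..} (\<lambda>s. f s powr \<alpha>)"
    and "continuous_on {0..} (\<lambda>s. exp s * f s powr \<alpha>)"
    and "(\<lambda>s. f s powr \<alpha>) integrable_on {0..t}"
    and "(\<lambda>s. exp s * f s powr \<alpha>) integrable_on {0..t}"
    and "(\<lambda>s. (1 - exp (s - t)) * f s powr \<alpha>) integrable_on {0..t}"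
proof -
  show *: "continuous_on {0..} (\<lambda>s. f s powr \<alpha>)"
    by (intro continuous_on_powr_nonneg) (use assms alpha in auto)
  show "continuous_on {0..} (\<lambda>s. exp s * f s powr \<alpha>)"
    by (intro continuous_intros *)
  have **: "continuous_on {0..t} (\<lambda>s. f s powr \<alpha>)"
    using * by (rule continuous_on_subset) auto
  show "(\<lambda>s. f s powr \<alpha>) integrable_on {0..t}"
    by (intro integrable_continuous_interval **)
  show "(\<lambda>s. exp s * f s powr \<alpha>) integrable_on {0..t}"
    by (intro integrable_continuous_interval continuous_intros **)
  show "(\<lambda>s. (1 - exp (s - t)) * f s powr \<alpha>) integrable_on {0..t}"
    by (intro integrable_continuous_interval continuous_intros **)
qed

text \<open>Integrability rather than continuity of \<open>f\<close> is assumed because the lemma is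
  also applied to a pointwise limit of iterates whose continuity is not yet known.\<close>

lemma picard_continuous:
  assumes "\<And>t. 0 \<le> t \<Longrightarrow> (\<lambda>s. f s powr \<alpha>) integrable_on {0..t}"
    and "\<And>t. 0 \<le> t \<Longrightarrow> (\<lambda>s. exp s * f s powr \<alpha>) integrable_on {0..t}"
  shows "continuous_on {0..} (picard \<alpha> f)"
proof (rule continuous_on_eq)
  show "continuous_on {0..} (\<lambda>t. integral {0..t} (\<lambda>s. f s powr \<alpha>)
    - exp (- t) * integral {0..t} (\<lambda>s. exp s * f s powr \<alpha>))"
    by (intro continuous_intros integral_from_0_continuous assms)
qed (simp add: picard_eq assms)

lemma picard_derivative:
  assumes "continuous_on {0..} f" "\<And>x. 0 \<le> x \<Longrightarrow> 0 \<le> f x" "0 < t"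
  shows "(picard \<alpha> f has_real_derivative
    exp (- t) * integral {0..t} (\<lambda>s. exp s * f s powr \<alpha>)) (at t)"
proof -
  note c = powr_integrable[OF assms(1,2)]
  have "((\<lambda>t. integral {0..t} (\<lambda>s. f s powr \<alpha>)
      - exp (- t) * integral {0..t} (\<lambda>s. exp s * f s powr \<alpha>)) has_real_derivative
      exp (- t) * integral {0..t} (\<lambda>s. exp s * f s powr \<alpha>)) (at t)"
    by (auto intro!: derivative_eq_intros integral_from_0_has_derivative[OF c(1) \<open>0 < t\<close>]
        integral_from_0_has_derivative[OF c(2) \<open>0 < t\<close>] simp: exp_minus)
  then show ?thesis
    by (rule has_field_derivative_transform_within_open[where S = "{0<..}"])
      (use assms c in \<open>auto simp: picard_eq\<close>)
qed

lemma picard_mono: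
  assumes "continuous_on {0..} f" "\<And>x. 0 \<le> x \<Longrightarrow> 0 \<le> f x"
    and "continuous_on {0..} g" "\<And>x. 0 \<le> x \<Longrightarrow> f x \<le> g x"
    and "0 \<le> t"
  shows "picard \<alpha> f t \<le> picard \<alpha> g t"
proof -
  have "0 \<le> g x" if "0 \<le> x" for x using assms(2,4) that by (meson order_trans)
  then show ?thesis
    unfolding picard_def using assms alpha
    by (intro integral_le powr_integrable mult_left_mono powr_mono2) auto
qed

text \<open>With \<open>m * \<alpha> = m - 2\<close> and a kernel at most \<open>1\<close>, the
  integrand is at most \<open>(1 + t) powr (m - 2)\<close>; the length \<open>t\<close> of the
  interval is absorbed by \<open>(1 + t) powr 2\<close>.\<close>

lemma picard_upper:
  assumes "continuous_on {0..} f" "\<And>x. 0 \<le> x \<Longrightarrow> 0 \<le> f x"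
    and "\<And>x. 0 \<le> x \<Longrightarrow> f x \<le> (1 + x) powr (2 / (1 - \<alpha>))"
    and "0 \<le> t"
  shows "picard \<alpha> f t \<le> (1 + t) powr (2 / (1 - \<alpha>))"
proof -
  let ?m = "2 / (1 - \<alpha>)"
  have m: "?m * \<alpha> = ?m - 2" using alpha by (simp add: field_simps)
  have "picard \<alpha> f t \<le> integral {0..t} (\<lambda>s. (1 + t) powr (?m - 2))"
    unfolding picard_def
  proof (intro integral_le powr_integrable assms)
    fix s assume s: "s \<in> {0..t}"
    have "f s powr \<alpha> \<le> ((1 + s) powr ?m) powr \<alpha>"
      using assms s alpha by (intro powr_mono2) auto
    also have "\<dots> = (1 + s) powr (?m - 2)" by (simp only: powr_powr m)
    also have "\<dots> \<le> (1 + t) powr (?m - 2)"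
      using s alpha by (intro powr_mono2) (auto simp: field_simps)
    finally have "f s powr \<alpha> \<le> (1 + t) powr (?m - 2)" .
    moreover have "1 - exp (s - t) \<le> 1" "0 \<le> 1 - exp (s - t)" using s by auto
    ultimately show "(1 - exp (s - t)) * f s powr \<alpha> \<le> (1 + t) powr (?m - 2)"
      using mult_mono[of "1 - exp (s - t)" 1 "f s powr \<alpha>"] by simp
  qed auto
  also have "\<dots> = t * (1 + t) powr (?m - 2)" using assms by simp
  also have "\<dots> \<le> (1 + t) powr 2 * (1 + t) powr (?m - 2)"
    using assms by (intro mult_right_mono) (auto simp: power2_eq_square algebra_simps)
  also have "\<dots> = (1 + t) powr ?m" by (simp flip: powr_add)
  finally show ?thesis .
qed

text \<open>With \<open>m = 2 / (1 - \<alpha>)\<close> the coefficient \<open>K\<close> solves \<open>m (m - 1) K = K powr \<alpha>\<close>, so that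
  \<open>K t powr m\<close> solves \<open>f'' = f powr \<alpha>\<close>; replacing \<open>t\<close> by \<open>1 - exp (- t)\<close> gives a subsolution of
  \<open>f'' + f' = f powr \<alpha>\<close>.\<close>

definition barrier :: "real \<Rightarrow> real" where
  "barrier t = ((1 - \<alpha>)\<^sup>2 / (2 * (1 + \<alpha>))) powr (1 / (1 - \<alpha>)) * (1 - exp (- t)) powr (2 / (1 - \<alpha>))"

lemma barrier_continuous: "continuous_on {0..} barrier"
  unfolding barrier_def
  by (intro continuous_intros continuous_on_powr_nonneg) (use alpha in auto)

lemma barrier_nonneg: "0 \<le> barrier t"
  by (simp add: barrier_def)

lemma barrier_pos: "0 < t \<Longrightarrow> 0 < barrier t"
  using alpha by (simp add: barrier_def)

lemma barrier_upper:
  assumes "0 \<le> t" shows "barrier t \<le> (1 + t) powr (2 / (1 - \<alpha>))"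
proof -
  have "(1 - \<alpha>)\<^sup>2 \<le> 1 * (2 * (1 + \<alpha>))"
    using alpha power_le_one[of "1 - \<alpha>" 2] by simp
  then have "(1 - \<alpha>)\<^sup>2 / (2 * (1 + \<alpha>)) \<le> 1" using alpha by (subst divide_le_eq) auto
  then have "((1 - \<alpha>)\<^sup>2 / (2 * (1 + \<alpha>))) powr (1 / (1 - \<alpha>)) \<le> 1"
    using alpha by (intro powr_le1) auto
  moreover have "(1 - exp (- t)) powr (2 / (1 - \<alpha>)) \<le> (1 + t) powr (2 / (1 - \<alpha>))"
    using alpha assms by (intro powr_mono2) (auto intro: order_trans[of _ 0])
  ultimately show ?thesis
    unfolding barrier_def using mult_mono[of "((1 - \<alpha>)\<^sup>2 / (2 * (1 + \<alpha>))) powr (1 / (1 - \<alpha>))" 1]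
    by fastforce
qed

lemma barrier_le_picard:
  assumes "0 \<le> t"
  shows "barrier t \<le> picard \<alpha> barrier t"
proof -
  define m K where "m = 2 / (1 - \<alpha>)" and "K = ((1 - \<alpha>)\<^sup>2 / (2 * (1 + \<alpha>))) powr (1 / (1 - \<alpha>))"
  have barrier: "barrier = (\<lambda>t. K * (1 - exp (- t)) powr m)"
    by (auto simp: barrier_def m_def K_def)
  have m: "2 < m" "m * \<alpha> = m - 2" using alpha by (auto simp: m_def field_simps)
  have K: "0 < K" using alpha by (auto simp: K_def)
  have "m * (m - 1) * ((1 - \<alpha>)\<^sup>2 / (2 * (1 + \<alpha>))) = 1"
    using alpha unfolding m_def by (simp add: divide_simps) (simp add: algebra_simps power2_eq_square)
  moreover have "K powr (1 - \<alpha>) = (1 - \<alpha>)\<^sup>2 / (2 * (1 + \<alpha>))"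
    using alpha by (simp add: K_def powr_powr)
  ultimately have "m * (m - 1) * K powr (1 - \<alpha>) = 1" by (simp only:)
  then have "K powr \<alpha> = m * (m - 1) * (K powr (1 - \<alpha>) * K powr \<alpha>)" by simp
  then have Ka: "K powr \<alpha> = m * (m - 1) * K"
    using K by (simp flip: powr_add)
  have pow: "barrier s powr \<alpha> = m * (m - 1) * K * (1 - exp (- s)) powr (m - 2)" if "0 \<le> s" for s
    using that K by (simp add: barrier powr_mult powr_powr m Ka)
  note c = powr_integrable[OF barrier_continuous barrier_nonneg]
  let ?H = "\<lambda>t. integral {0..t} (\<lambda>s. exp s * barrier s powr \<alpha>)"
  \<comment> \<open>\<open>?H t\<close> and the left-hand side are \<open>exp t\<close> times the
    derivatives of \<open>picard \<alpha> barrier\<close> and of \<open>barrier\<close>. Their own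
    derivatives differ only by the factors \<open>exp x\<close> and
    \<open>exp (- x)\<close>.\<close>
  have H: "K * m * (1 - exp (- t)) powr (m - 1) \<le> ?H t" if "0 \<le> t" for t
  proof -
    have "?H 0 - K * m * (1 - exp (- 0)) powr (m - 1) \<le> ?H t - K * m * (1 - exp (- t)) powr (m - 1)"
    proof (rule nondecreasing_from_derivative[OF that])
      have "continuous_on {0..t} ?H"
        by (intro continuous_on_subset[OF integral_from_0_continuous] c) auto
      then show "continuous_on {0..t} (\<lambda>t. ?H t - K * m * (1 - exp (- t)) powr (m - 1))"
        using m by (intro continuous_intros continuous_on_powr_nonneg) auto
      fix x assume x: "0 < x" "x < t"
      show "((\<lambda>t. ?H t - K * m * (1 - exp (- t)) powr (m - 1)) has_real_derivative
        exp x * barrier x powr \<alpha> - K * m * ((m - 1) * (1 - exp (- x)) powr (m - 2) * exp (- x))) (at x)"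
        by (rule derivative_eq_intros integral_from_0_has_derivative c x refl DERIV_fun_powr | simp add: x)+
      have "exp (- x) \<le> exp x" using x by simp
      then show "0 \<le> exp x * barrier x powr \<alpha> - K * m * ((m - 1) * (1 - exp (- x)) powr (m - 2) * exp (- x))"
        using x m K mult_left_mono[of "exp (- x)" "exp x" "K * m * (m - 1) * (1 - exp (- x)) powr (m - 2)"]
        by (simp add: pow algebra_simps)
    qed
    then show ?thesis by simp
  qed
  have "picard \<alpha> barrier 0 - barrier 0 \<le> picard \<alpha> barrier t - barrier t"
  proof (rule nondecreasing_from_derivative[OF assms])
    have "continuous_on {0..} (picard \<alpha> barrier)"
      by (intro picard_continuous c)
    then show "continuous_on {0..t} (\<lambda>t. picard \<alpha> barrier t - barrier t)"
      by (intro continuous_intros continuous_on_subset[OF barrier_continuous])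
        (auto intro: continuous_on_subset)
    fix x assume x: "0 < x" "x < t"
    show "((\<lambda>t. picard \<alpha> barrier t - barrier t) has_real_derivative
      exp (- x) * ?H x - K * (m * (1 - exp (- x)) powr (m - 1) * exp (- x))) (at x)"
      unfolding barrier[THEN fun_cong]
      by (rule derivative_eq_intros picard_derivative[OF barrier_continuous barrier_nonneg, unfolded barrier] x refl DERIV_fun_powr | simp add: x barrier)+
    show "0 \<le> exp (- x) * ?H x - K * (m * (1 - exp (- x)) powr (m - 1) * exp (- x))"
      using mult_left_mono[OF H, of x "exp (- x)"] x by (simp add: algebra_simps)
  qed
  then show ?thesis by (simp add: picard_def barrier)
qed

end

section \<open>Convergence of the iteration\<close>

context
  fixes \<alpha> :: real
  assumes alpha: "0 < \<alpha>" "\<alpha> < 1"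
begin

text \<open>The increase starts from \<open>barrier_le_picard\<close> and is propagated by
  \<open>picard_mono\<close>, which in turn needs the continuity of the iterates; hence one joint
  induction.\<close>

lemma picard_iterates:
  defines "f \<equiv> \<lambda>n. (picard \<alpha> ^^ n) (barrier \<alpha>)"
  shows "continuous_on {0..} (f n)"
    and "\<And>t. 0 \<le> t \<Longrightarrow> barrier \<alpha> t \<le> f n t \<and> f n t \<le> f (Suc n) t \<and> f n t \<le> (1 + t) powr (2 / (1 - \<alpha>))"
proof (induction n)
  case 0
  show "continuous_on {0..} (f 0)" by (simp add: f_def barrier_continuous alpha)
  show "barrier \<alpha> t \<le> f 0 t \<and> f 0 t \<le> f (Suc 0) t \<and> f 0 t \<le> (1 + t) powr (2 / (1 - \<alpha>))"
    if "0 \<le> t" for t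
    using that by (simp add: f_def barrier_le_picard barrier_upper alpha)
next
  case (Suc n)
  have nn: "0 \<le> f n t" if "0 \<le> t" for t
    using Suc.IH(2)[OF that] barrier_nonneg[OF alpha, of t] by linarith
  have eq: "f (Suc n) = picard \<alpha> (f n)" for n by (simp add: f_def)
  note c = powr_integrable[OF alpha Suc.IH(1) nn]
  show cont: "continuous_on {0..} (f (Suc n))"
    unfolding eq by (intro picard_continuous alpha c)
  show "barrier \<alpha> t \<le> f (Suc n) t \<and> f (Suc n) t \<le> f (Suc (Suc n)) t
      \<and> f (Suc n) t \<le> (1 + t) powr (2 / (1 - \<alpha>))" if t: "0 \<le> t" for t
  proof (intro conjI)
    show "barrier \<alpha> t \<le> f (Suc n) t" using Suc.IH(2)[OF t] by linarith
    have "picard \<alpha> (f n) t \<le> picard \<alpha> (f (Suc n)) t"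
      by (intro picard_mono alpha Suc.IH(1) cont nn t) (use Suc.IH(2) in auto)
    then show "f (Suc n) t \<le> f (Suc (Suc n)) t" by (simp add: eq)
    have "picard \<alpha> (f n) t \<le> (1 + t) powr (2 / (1 - \<alpha>))"
      by (intro picard_upper alpha Suc.IH(1) nn t) (use Suc.IH(2) in auto)
    then show "f (Suc n) t \<le> (1 + t) powr (2 / (1 - \<alpha>))" by (simp add: eq)
  qed
qed

lemma picard_fixed_point:
  obtains w where "\<And>t. 0 \<le> t \<Longrightarrow> w t = picard \<alpha> w t" "continuous_on {0..} w"
    "\<And>t. 0 \<le> t \<Longrightarrow> barrier \<alpha> t \<le> w t" "\<And>t. 0 \<le> t \<Longrightarrow> w t \<le> (1 + t) powr (2 / (1 - \<alpha>))"
proof -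
  define f where "f n = (picard \<alpha> ^^ n) (barrier \<alpha>)" for n
  let ?u = "\<lambda>t. (1 + t) powr (2 / (1 - \<alpha>))"
  note f = picard_iterates[folded f_def]
  define w where "w t = lim (\<lambda>n. f n t)" for t
  have lim: "(\<lambda>n. f n t) \<longlonglongrightarrow> w t" if "0 \<le> t" for t
  proof -
    have "incseq (\<lambda>n. f n t)" using f(2)[OF that] by (intro incseq_SucI) auto
    then obtain L where "(\<lambda>n. f n t) \<longlonglongrightarrow> L"
      by (rule incseq_convergent) (use f(2)[OF \<open>0 \<le> t\<close>] in blast)
    then show ?thesis unfolding w_def by (metis limI)
  qed
  have lower: "barrier \<alpha> t \<le> w t" if "0 \<le> t" for t
    by (intro LIMSEQ_le_const[OF lim[OF that]]) (use f(2)[OF that] in auto)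
  have upper: "w t \<le> ?u t" if "0 \<le> t" for t
    by (intro LIMSEQ_le_const2[OF lim[OF that]]) (use f(2)[OF that] in auto)
  have nn: "0 \<le> f n t" if "0 \<le> t" for n t
    using f(2)[OF that, of n] barrier_nonneg[OF alpha, of t] by linarith
  have u_cont: "continuous_on {0..} ?u"
    using alpha by (intro continuous_on_powr_nonneg continuous_intros) auto
  \<comment> \<open>Dominated convergence with a majorant built from \<open>?u\<close>. The weight
    \<open>g\<close> is free since three are used below: the kernel for the fixed point equation,
    and \<open>1\<close> and \<open>exp\<close> for the integrability required by
    \<open>picard_continuous\<close>.\<close>
  have weighted: "(\<lambda>s. g s * w s powr \<alpha>) integrable_on {0..t} \<and>
      (\<lambda>n. integral {0..t} (\<lambda>s. g s * f n s powr \<alpha>))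
        \<longlonglongrightarrow> integral {0..t} (\<lambda>s. g s * w s powr \<alpha>)"
    if g: "continuous_on {0..t} g" for g t
  proof -
    have cont_powr: "continuous_on {0..t} (\<lambda>s. h s powr \<alpha>)"
      if "continuous_on {0..} h" "\<And>s. 0 \<le> s \<Longrightarrow> 0 \<le> h s" for h
      by (rule continuous_on_subset[OF powr_integrable(1)[OF alpha that]]) auto
    have f_int: "(\<lambda>s. g s * f n s powr \<alpha>) integrable_on {0..t}" for n
      by (intro integrable_continuous_interval continuous_on_mult g cont_powr f(1) nn)
    have u_int: "(\<lambda>s. \<bar>g s\<bar> * ?u s powr \<alpha>) integrable_on {0..t}"
      by (intro integrable_continuous_interval continuous_on_mult continuous_on_rabs g cont_powr u_cont)
        auto
    have dom: "norm (g s * f n s powr \<alpha>) \<le> \<bar>g s\<bar> * ?u s powr \<alpha>" if "s \<in> {0..t}" for n s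
      unfolding real_norm_def abs_mult
      using that f(2)[of s n] nn[of s n] alpha
      by (intro mult_left_mono) (auto intro!: powr_mono2)
    have conv: "(\<lambda>n. g s * f n s powr \<alpha>) \<longlonglongrightarrow> g s * w s powr \<alpha>" if "s \<in> {0..t}" for s
      using that alpha by (intro tendsto_mult tendsto_const tendsto_powr' lim) (auto simp: nn)
    show ?thesis
      using dominated_convergence[OF f_int u_int dom conv] by blast
  qed
  have fix_point: "w t = picard \<alpha> w t" if "0 \<le> t" for t
  proof (rule LIMSEQ_unique)
    show "(\<lambda>n. f (Suc n) t) \<longlonglongrightarrow> w t" using lim[OF that] by (rule LIMSEQ_Suc)
    have "continuous_on {0..t} (\<lambda>s. 1 - exp (s - t))" by (intro continuous_intros)
    from weighted[OF this] show "(\<lambda>n. f (Suc n) t) \<longlonglongrightarrow> picard \<alpha> w t"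
      by (simp add: f_def picard_def)
  qed
  \<comment> \<open>Continuity of the limit comes from the fixed point equation, not from uniform
    convergence.\<close>
  have "continuous_on {0..} (picard \<alpha> w)"
  proof (rule picard_continuous[OF alpha])
    show "(\<lambda>s. w s powr \<alpha>) integrable_on {0..t}" for t
      using weighted[of t "\<lambda>s. 1"] by simp
    show "(\<lambda>s. exp s * w s powr \<alpha>) integrable_on {0..t}" for t
      using weighted[of t exp] by (simp add: continuous_on_exp)
  qed
  then have "continuous_on {0..} w"
    by (rule continuous_on_eq) (simp add: fix_point[symmetric])
  with fix_point lower upper show ?thesis using that by blast
qed

end

text \<open>\<open>lower\<close> singles out the positive solution and controls its order of
  vanishing at \<open>0\<close>; \<open>upper\<close> is what makes \<open>slope\<close> small for
  large times.\<close>

locale profile =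
  fixes \<alpha> :: real and w w' :: "real \<Rightarrow> real"
  assumes alpha: "0 < \<alpha>" "\<alpha> < 1"
    and cont: "continuous_on {0..} w" "continuous_on {0..} w'"
    and at_0: "w 0 = 0" "w' 0 = 0"
    and deriv_w: "\<And>t. 0 < t \<Longrightarrow> (w has_real_derivative w' t) (at t)"
    and deriv_w': "\<And>t. 0 < t \<Longrightarrow> (w' has_real_derivative w t powr \<alpha> - w' t) (at t)"
    and lower: "\<And>t. 0 \<le> t \<Longrightarrow> barrier \<alpha> t \<le> w t"
    and upper: "\<And>t. 0 \<le> t \<Longrightarrow> w t \<le> (1 + t) powr (2 / (1 - \<alpha>))"

lemma profile_exists:
  assumes alpha: "0 < \<alpha>" "\<alpha> < 1"
  obtains w w' where "profile \<alpha> w w'"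
proof -
  obtain w where w: "\<And>t. 0 \<le> t \<Longrightarrow> w t = picard \<alpha> w t" "continuous_on {0..} w"
    "\<And>t. 0 \<le> t \<Longrightarrow> barrier \<alpha> t \<le> w t" "\<And>t. 0 \<le> t \<Longrightarrow> w t \<le> (1 + t) powr (2 / (1 - \<alpha>))"
    using picard_fixed_point[OF alpha] by metis
  have nn: "0 \<le> w t" if "0 \<le> t" for t
    using w(3)[OF that] barrier_nonneg[OF alpha, of t] by linarith
  note c = powr_integrable[OF alpha w(2) nn]
  define w' where "w' t = exp (- t) * integral {0..t} (\<lambda>s. exp s * w s powr \<alpha>)" for t
  have "profile \<alpha> w w'"
  proof
    show "continuous_on {0..} w'"
      unfolding w'_def by (intro continuous_intros integral_from_0_continuous c)
    show "w 0 = 0" "w' 0 = 0" using w(1)[of 0] by (simp_all add: picard_def w'_def)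
    fix t :: real assume t: "0 < t"
    have "(picard \<alpha> w has_real_derivative w' t) (at t)"
      unfolding w'_def by (rule picard_derivative[OF alpha w(2) nn t])
    then show "(w has_real_derivative w' t) (at t)"
      by (rule has_field_derivative_transform_within_open[where S = "{0<..}"])
        (use t w(1) in auto)
    show "(w' has_real_derivative w t powr \<alpha> - w' t) (at t)"
      unfolding w'_def
      by (auto intro!: derivative_eq_intros integral_from_0_has_derivative[OF c(2) t]
          simp: exp_minus)
  qed (use alpha w in auto)
  then show ?thesis by (rule that)
qed

section \<open>Comparison and uniqueness\<close>

text \<open>A first-order system with continuity alone at the end points, so that comparison needs
  no one-sided derivatives.\<close>

definition solves :: "real \<Rightarrow> real \<Rightarrow> (real \<Rightarrow> real) \<Rightarrow> (real \<Rightarrow> real) \<Rightarrow> bool" where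
  "solves \<alpha> T u p \<longleftrightarrow> continuous_on {0..T} u \<and> continuous_on {0..T} p \<and> (\<forall>t\<in>{0..T}. 0 \<le> u t) \<and>
    (\<forall>t\<in>{0<..<T}. (u has_real_derivative p t) (at t) \<and>
      (p has_real_derivative u t powr \<alpha> - p t) (at t))"

lemma solves_subinterval:
  assumes "solves \<alpha> T u p" "S \<le> T"
  shows "solves \<alpha> S u p"
  using assms unfolding solves_def by (auto intro: continuous_on_subset)

lemma solves_shift:
  assumes "solves \<alpha> T u p" "0 \<le> \<epsilon>"
  shows "solves \<alpha> (T - \<epsilon>) (\<lambda>t. u (t + \<epsilon>)) (\<lambda>t. p (t + \<epsilon>))"
proof -
  have "continuous_on {0..T - \<epsilon>} (\<lambda>t. f (t + \<epsilon>))" if "continuous_on {0..T} f" for f :: "real \<Rightarrow> real"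
    by (intro continuous_on_compose2[OF that] continuous_intros) (use assms(2) in auto)
  then show ?thesis
    using assms unfolding solves_def
    by (auto simp flip: DERIV_shift)
qed

text \<open>The integrating factor \<open>exp t\<close> cancels the damping and leaves
  \<open>exp t * (x t powr \<alpha> - u t powr \<alpha>)\<close> as derivative.\<close>

lemma solves_velocity_difference:
  assumes u: "solves \<alpha> T u p" and x: "solves \<alpha> T x y" and "0 \<le> \<alpha>"
    and le: "\<And>t. 0 < t \<Longrightarrow> t < T \<Longrightarrow> u t \<le> x t" and "p 0 \<le> y 0" "0 \<le> T"
  shows "p T \<le> y T"
proof -
  note [unfolded solves_def, simp] = u x
  have "exp 0 * (y 0 - p 0) \<le> exp T * (y T - p T)"
  proof (rule nondecreasing_from_derivative[OF \<open>0 \<le> T\<close>])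
    show "continuous_on {0..T} (\<lambda>t. exp t * (y t - p t))"
      by (intro continuous_intros) auto
    fix t assume t: "0 < t" "t < T"
    have "(y has_real_derivative x t powr \<alpha> - y t) (at t)"
      "(p has_real_derivative u t powr \<alpha> - p t) (at t)" using t by auto
    then show "((\<lambda>t. exp t * (y t - p t)) has_real_derivative
        exp t * (x t powr \<alpha> - u t powr \<alpha>)) (at t)"
      by (auto intro!: derivative_eq_intros simp: algebra_simps)
    have "u t powr \<alpha> \<le> x t powr \<alpha>"
      using t assms(3) le by (intro powr_mono2) auto
    then show "0 \<le> exp t * (x t powr \<alpha> - u t powr \<alpha>)" by simp
  qed
  then have "0 \<le> exp T * (y T - p T)" using assms(5) by simp
  then show ?thesis by (simp add: zero_le_mult_iff)
qed

text \<open>Up to the first contact \<open>s\<close> the velocities are ordered, so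
  \<open>x - u\<close> is nondecreasing on \<open>{0..s}\<close> and cannot have come down to
  \<open>0\<close>.\<close>

lemma solves_comparison:
  assumes u: "solves \<alpha> T u p" and x: "solves \<alpha> T x y" and "0 \<le> \<alpha>"
    and "u 0 < x 0" "p 0 \<le> y 0" and t: "0 \<le> t" "t \<le> T"
  shows "u t < x t"
proof (rule ccontr)
  assume "\<not> u t < x t"
  define S where "S = {r \<in> {0..T}. x r \<le> u r}"
  have "t \<in> S" using t \<open>\<not> u t < x t\<close> by (auto simp: S_def)
  have "closed S" unfolding S_def
    using u x by (intro continuous_on_closed_Collect_le) (auto simp: solves_def)
  have bdd: "bdd_below S" by (auto simp: S_def bdd_below_def)
  define s where "s = Inf S"
  have s: "s \<in> S" unfolding s_def
    using \<open>t \<in> S\<close> \<open>closed S\<close> bdd closed_contains_Inf by blast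
  have before: "u r < x r" if "0 \<le> r" "r < s" for r
  proof (rule ccontr)
    assume "\<not> u r < x r"
    then have "r \<in> S" using that s by (auto simp: S_def)
    then show False using cInf_lower[OF _ bdd, of r] that by (simp add: s_def)
  qed
  have s_le: "s \<le> T" and s_ge: "0 \<le> s" using s by (auto simp: S_def)
  have y: "p r \<le> y r" if "0 \<le> r" "r \<le> s" for r
    by (rule solves_velocity_difference[OF solves_subinterval[OF u] solves_subinterval[OF x]])
      (use that s_le before assms in \<open>auto intro: less_imp_le\<close>)
  have "x 0 - u 0 \<le> x s - u s"
  proof (rule nondecreasing_from_derivative[OF s_ge])
    show "continuous_on {0..s} (\<lambda>r. x r - u r)"
      using solves_subinterval[OF u s_le] solves_subinterval[OF x s_le]
      by (intro continuous_intros) (auto simp: solves_def)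
    fix r assume r: "0 < r" "r < s"
    then show "((\<lambda>r. x r - u r) has_real_derivative y r - p r) (at r)"
      using u x s_le by (intro DERIV_diff) (auto simp: solves_def)
    show "0 \<le> y r - p r" using y r by simp
  qed
  then show False using s assms(4) by (simp add: S_def)
qed

text \<open>The right-hand side is not Lipschitz at zero; comparing with the shifts \<open>x (t + \<epsilon>)\<close>, which start
  strictly above \<open>u\<close>, avoids this.\<close>

lemma solves_from_rest_le:
  assumes u: "solves \<alpha> T u p" and x: "solves \<alpha> T x y" and \<alpha>: "0 \<le> \<alpha>"
    and rest: "u 0 = 0" "p 0 = 0" "x 0 = 0" "y 0 = 0"
    and pos: "\<And>t. 0 < t \<Longrightarrow> t < T \<Longrightarrow> 0 < x t"
    and t: "0 \<le> t" "t < T"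
  shows "u t \<le> x t"
proof -
  have zero: "solves \<alpha> S (\<lambda>_. 0) (\<lambda>_. 0)" for S by (simp add: solves_def)
  \<comment> \<open>Comparison with the zero solution: the shifted solution starts with at least the
    velocity \<open>0\<close> of \<open>u\<close>.\<close>
  have y: "0 \<le> y t" if "0 \<le> t" "t < T" for t
    by (rule solves_velocity_difference[OF zero solves_subinterval[OF x] \<alpha>])
      (use that rest pos in \<open>auto intro: less_imp_le\<close>)
  have less: "u t < x (t + \<epsilon>)" if "0 < \<epsilon>" "\<epsilon> < T - t" for \<epsilon>
  proof -
    have "solves \<alpha> (T - \<epsilon>) u p" using u that by (auto intro: solves_subinterval)
    moreover have "solves \<alpha> (T - \<epsilon>) (\<lambda>t. x (t + \<epsilon>)) (\<lambda>t. y (t + \<epsilon>))"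
      using x that by (auto intro: solves_shift)
    ultimately show ?thesis
      by (rule solves_comparison[OF _ _ \<alpha>]) (use that t rest pos y in auto)
  qed
  have "continuous_on {t..T} x"
    using x t unfolding solves_def by (auto intro: continuous_on_subset)
  then have "(x \<longlongrightarrow> x t) (at_right t)"
    using t by (intro continuous_on_Icc_at_rightD) auto
  moreover have "\<forall>\<^sub>F r in at_right t. u t \<le> x r"
  proof (rule eventually_at_rightI)
    show "u t \<le> x r" if "r \<in> {t<..<T}" for r using less[of "r - t"] that by simp
  qed (use t in simp)
  ultimately show ?thesis by (rule tendsto_lowerbound) simp
qed

text \<open>Positivity excludes solutions that rest at \<open>0\<close> for a while; with it the
  comparison runs in both directions.\<close>

lemma solves_from_rest_unique:
  assumes u: "solves \<alpha> T u p" and x: "solves \<alpha> T x y" and \<alpha>: "0 \<le> \<alpha>"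
    and rest: "u 0 = 0" "p 0 = 0" "x 0 = 0" "y 0 = 0"
    and pos: "\<And>t. 0 < t \<Longrightarrow> t < T \<Longrightarrow> 0 < u t \<and> 0 < x t"
    and t: "0 \<le> t" "t \<le> T"
  shows "u t = x t \<and> p t = y t"
proof (cases "t = 0")
  case False
  then have T: "0 < T" using t by simp
  have eq: "u r = x r" if "0 \<le> r" "r < T" for r
    using solves_from_rest_le[OF u x \<alpha> rest] solves_from_rest_le[OF x u \<alpha> rest(3,4,1,2)] pos that
    by (meson order_antisym)
  have eq': "p r = y r" if r: "0 < r" "r < T" for r
  proof (rule DERIV_unique)
    show "(u has_real_derivative p r) (at r)" using u r by (auto simp: solves_def)
    have "(x has_real_derivative y r) (at r)" using x r by (auto simp: solves_def)
    then show "(u has_real_derivative y r) (at r)"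
      by (rule has_field_derivative_transform_within_open[where S = "{0<..<T}"])
        (use r eq in auto)
  qed
  show ?thesis
  proof (cases "t < T")
    case True
    then show ?thesis using eq eq' t False by auto
  next
    case at_end: False
    \<comment> \<open>Equality is known so far only before \<open>T\<close>; continuity carries it
      to the end point.\<close>
    have lim: "f T = g T" if "continuous_on {0..T} f" "continuous_on {0..T} g"
      "\<And>r. 0 < r \<Longrightarrow> r < T \<Longrightarrow> f r = g r" for f g :: "real \<Rightarrow> real"
    proof (rule tendsto_unique)
      show "(f \<longlongrightarrow> f T) (at_left T)" by (rule continuous_on_Icc_at_leftD[OF that(1) T])
      have "\<forall>\<^sub>F r in at_left T. g r = f r"
        by (rule eventually_at_leftI[OF _ T]) (use that in simp)
      moreover have "(g \<longlongrightarrow> g T) (at_left T)" by (rule continuous_on_Icc_at_leftD[OF that(2) T])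
      ultimately show "(f \<longlongrightarrow> g T) (at_left T)" by (simp cong: tendsto_cong)
    qed simp
    have "t = T" using at_end t by simp
    then show ?thesis
      using lim[of u x] lim[of p y] u x eq eq' by (auto simp: solves_def)
  qed
qed (use rest in simp)

section \<open>Shape of the profile: positivity and logarithmic derivative\<close>

context profile
begin

lemma pos: "0 < t \<Longrightarrow> 0 < w t"
  using lower[of t] barrier_pos[OF alpha, of t] by linarith

lemma cont_sub: "S \<subseteq> {0..} \<Longrightarrow> continuous_on S w" "S \<subseteq> {0..} \<Longrightarrow> continuous_on S w'"
  using cont by (auto intro: continuous_on_subset)

lemma nonneg: "0 \<le> t \<Longrightarrow> 0 \<le> w t"
  using pos[of t] at_0 by (cases "t = 0") auto

lemma solves_profile: "solves \<alpha> T w w'"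
  unfolding solves_def using cont_sub[of "{0..T}"] deriv_w deriv_w' nonneg by auto

lemma unique:
  assumes "solves \<alpha> T u p" "u 0 = 0" "p 0 = 0" "\<And>t. 0 < t \<Longrightarrow> t < T \<Longrightarrow> 0 < u t" "0 \<le> t" "t \<le> T"
  shows "u t = w t" "p t = w' t"
  using solves_from_rest_unique[OF assms(1) solves_profile] assms pos at_0 alpha by auto

lemma pos':
  assumes "0 < t" shows "0 < w' t"
proof -
  have "exp 0 * w' 0 < exp t * w' t"
  proof (rule DERIV_pos_imp_increasing_open[OF assms])
    fix r :: real assume r: "0 < r"
    have "((\<lambda>r. exp r * w' r) has_real_derivative exp r * w r powr \<alpha>) (at r)"
      using deriv_w'[OF r] by (auto intro!: derivative_eq_intros simp: algebra_simps)
    then show "\<exists>d. ((\<lambda>r. exp r * w' r) has_real_derivative d) (at r) \<and> 0 < d"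
      using pos[OF r] by (intro exI[of _ "exp r * w r powr \<alpha>"]) auto
  qed (auto intro!: continuous_intros cont_sub)
  then show ?thesis using at_0 by (simp add: zero_less_mult_iff)
qed

text \<open>The logarithmic derivative does not see the amplitude; the boundary conditions prescribe
  its value \<open>(1 - v0) / v0\<close> at \<open>T\<close>.\<close>

definition slope :: "real \<Rightarrow> real" where
  "slope t = w' t / w t"

text \<open>Reading \<open>w''\<close> for \<open>w powr \<alpha> - w'\<close>, this says that
  \<open>slope\<close> has negative derivative.\<close>

lemma log_concavity:
  assumes "0 < t"
  shows "w t powr \<alpha> * w t - w' t * w t < w' t * w' t"
proof -
  \<comment> \<open>The difference \<open>Z\<close> of the two sides satisfies \<open>Z' + Z = (1 - \<alpha>) w powr \<alpha> w'\<close>.\<close>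
  define Z where "Z = (\<lambda>t. w' t * w' t - w t powr (1 + \<alpha>) + w t * w' t)"
  have "exp 0 * Z 0 < exp t * Z t"
  proof (rule DERIV_pos_imp_increasing_open[OF assms])
    fix r :: real assume r: "0 < r"
    have [simp]: "w r powr (1 + \<alpha>) = w r powr \<alpha> * w r" using pos[OF r] by (simp add: powr_add)
    then have "((\<lambda>r. exp r * Z r) has_real_derivative exp r * ((1 - \<alpha>) * w r powr \<alpha> * w' r)) (at r)"
      unfolding Z_def using pos[OF r]
      by (auto intro!: derivative_eq_intros DERIV_fun_powr deriv_w' deriv_w r simp: algebra_simps)
    then show "\<exists>d. ((\<lambda>r. exp r * Z r) has_real_derivative d) (at r) \<and> 0 < d"
      using pos[OF r] pos'[OF r] alpha
      by (intro exI[of _ "exp r * ((1 - \<alpha>) * w r powr \<alpha> * w' r)"]) auto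
  next
    show "continuous_on {0..t} (\<lambda>r. exp r * Z r)" unfolding Z_def
      using alpha
      by (intro continuous_on_mult continuous_on_add continuous_on_diff continuous_on_exp
          continuous_on_id cont_sub continuous_on_powr_nonneg) (auto simp: nonneg)
  qed
  then have "0 < Z t" using at_0 by (simp add: Z_def zero_less_mult_iff)
  then show ?thesis using pos[OF assms] by (simp add: Z_def powr_add algebra_simps)
qed

lemma slope_pos: "0 < t \<Longrightarrow> 0 < slope t"
  by (simp add: slope_def pos pos')

lemma slope_strict_antimono:
  assumes "0 < s" "s < t" shows "slope t < slope s"
proof (rule DERIV_neg_imp_decreasing[OF assms(2)])
  fix r assume "s \<le> r"
  then have r: "0 < r" using assms by simp
  have "(slope has_real_derivative ((w r powr \<alpha> - w' r) * w r - w' r * w' r) / (w r * w r)) (at r)"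
    unfolding slope_def using pos[OF r] by (intro DERIV_divide deriv_w deriv_w' r) auto
  moreover have "((w r powr \<alpha> - w' r) * w r - w' r * w' r) / (w r * w r) < 0"
    using log_concavity[OF r] pos[OF r] by (intro divide_neg_pos) (auto simp: algebra_simps)
  ultimately show "\<exists>d. (slope has_real_derivative d) (at r) \<and> d < 0" by blast
qed

lemma slope_inj: "0 < s \<Longrightarrow> 0 < t \<Longrightarrow> slope s = slope t \<Longrightarrow> s = t"
  using slope_strict_antimono[of s t] slope_strict_antimono[of t s] by (cases s t rule: linorder_cases) auto

lemma slope_continuous: "S \<subseteq> {0<..} \<Longrightarrow> continuous_on S slope"
  unfolding slope_def using pos by (intro continuous_intros cont_sub) force+

text \<open>If \<open>w' \<le> C * w\<close> held throughout, \<open>exp (- C * t) * w t\<close>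
  would be nonincreasing from the value \<open>0\<close>, against positivity.\<close>

lemma slope_unbounded: "\<exists>t>0. C < slope t"
proof (rule ccontr)
  assume contr: "\<not> ?thesis"
  have le: "w' t \<le> C * w t" if "0 < t" for t
  proof -
    have "w' t / w t \<le> C" using contr that by (metis slope_def not_less)
    then show ?thesis using pos[OF that] by (simp add: pos_divide_le_eq)
  qed
  have "- (exp (- C * 0) * w 0) \<le> - (exp (- C * 1) * w 1)"
  proof (rule nondecreasing_from_derivative[where f = "\<lambda>t. - (exp (- C * t) * w t)"])
    show "continuous_on {0..1} (\<lambda>t. - (exp (- C * t) * w t))"
      by (intro continuous_intros cont_sub) auto
    fix t :: real assume t: "0 < t"
    show "((\<lambda>t. - (exp (- C * t) * w t)) has_real_derivative exp (- C * t) * (C * w t - w' t)) (at t)"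
      by (auto intro!: derivative_eq_intros deriv_w t simp: algebra_simps)
    show "0 \<le> exp (- C * t) * (C * w t - w' t)" using le[OF t] by simp
  qed simp
  then show False using pos[of 1] at_0 by (simp add: mult_le_0_iff)
qed

text \<open>A positive lower bound for \<open>slope\<close> forces exponential growth of
  \<open>w\<close>, against the polynomial bound \<open>upper\<close>.\<close>

lemma slope_small:
  assumes "0 < \<epsilon>" shows "\<exists>t>0. slope t < \<epsilon>"
proof (rule ccontr)
  assume contr: "\<not> ?thesis"
  have le: "\<epsilon> * w t \<le> w' t" if "0 < t" for t
  proof -
    have "\<epsilon> \<le> w' t / w t" using contr that by (metis slope_def not_less)
    then show ?thesis using pos[OF that] by (simp add: pos_le_divide_eq)
  qed
  have ge: "exp (- \<epsilon>) * w 1 \<le> exp (- \<epsilon> * t) * (1 + t) powr (2 / (1 - \<alpha>))" if "1 \<le> t" for t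
  proof -
    have "exp (- \<epsilon> * 1) * w 1 \<le> exp (- \<epsilon> * t) * w t"
    proof (rule nondecreasing_from_derivative[OF that])
      show "continuous_on {1..t} (\<lambda>t. exp (- \<epsilon> * t) * w t)"
        by (intro continuous_intros cont_sub) auto
      fix t :: real assume "1 < t"
      then have t: "0 < t" by simp
      show "((\<lambda>t. exp (- \<epsilon> * t) * w t) has_real_derivative exp (- \<epsilon> * t) * (w' t - \<epsilon> * w t)) (at t)"
        by (auto intro!: derivative_eq_intros deriv_w t simp: algebra_simps)
      show "0 \<le> exp (- \<epsilon> * t) * (w' t - \<epsilon> * w t)" using le[OF t] by simp
    qed
    also have "\<dots> \<le> exp (- \<epsilon> * t) * (1 + t) powr (2 / (1 - \<alpha>))"
      using upper[of t] that by simp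
    finally show ?thesis by simp
  qed
  have "((\<lambda>t. exp (- \<epsilon> * t) * (1 + t) powr (2 / (1 - \<alpha>))) \<longlongrightarrow> 0) at_top"
    using assms by real_asymp
  moreover have "\<forall>\<^sub>F t in at_top. exp (- \<epsilon>) * w 1 \<le> exp (- \<epsilon> * t) * (1 + t) powr (2 / (1 - \<alpha>))"
    using eventually_ge_at_top[of 1] by eventually_elim (rule ge)
  ultimately have "exp (- \<epsilon>) * w 1 \<le> 0" by (rule tendsto_lowerbound) simp
  then show False using pos[of 1] by (simp add: mult_le_0_iff)
qed

lemma slope_surj:
  assumes "0 < r" shows "\<exists>t>0. slope t = r"
proof -
  obtain a b where ab: "0 < a" "r < slope a" "0 < b" "slope b < r"
    using slope_unbounded slope_small assms by metis
  then have "a < b"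
    using slope_strict_antimono[of b a] by (cases a b rule: linorder_cases) auto
  then obtain t where "a \<le> t" "slope t = r"
    using IVT2'[of slope b r a] slope_continuous[of "{a..b}"] ab
    by (fastforce simp: subset_iff less_imp_le)
  then show ?thesis using ab by (intro exI[of _ t]) auto
qed

end

section \<open>Smoothness of the profile\<close>

context profile
begin

text \<open>The sums of these monomials are closed under differentiation along the profile equation.\<close>

inductive_set diff_algebra :: "(real \<Rightarrow> real) set" where
  monomial: "(\<lambda>t. a * w t powr b * w' t ^ k) \<in> diff_algebra"
| sum: "f \<in> diff_algebra \<Longrightarrow> g \<in> diff_algebra \<Longrightarrow> (\<lambda>t. f t + g t) \<in> diff_algebra"

lemma diff_algebra_deriv:
  "f \<in> diff_algebra \<Longrightarrow> \<exists>g\<in>diff_algebra. \<forall>t>0. (f has_real_derivative g t) (at t)"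
proof (induction rule: diff_algebra.induct)
  case (monomial a b k)
  \<comment> \<open>The last two terms come from \<open>w'' = w powr \<alpha> - w'\<close>; for
    \<open>k = 0\<close> the truncated \<open>k - 1\<close> is harmless since the factor
    \<open>real k\<close> vanishes.\<close>
  let ?g = "\<lambda>t. a * b * w t powr (b - 1) * w' t ^ Suc k + (a * real k * w t powr (b + \<alpha>) * w' t ^ (k - 1)
    + - a * real k * w t powr b * w' t ^ k)"
  have "((\<lambda>t. a * w t powr b * w' t ^ k) has_real_derivative ?g t) (at t)" if t: "0 < t" for t
  proof -
    have "((\<lambda>t. a * w t powr b * w' t ^ k) has_real_derivative
        a * (b * w t powr (b - 1) * w' t) * w' t ^ k
        + a * w t powr b * (real k * w' t ^ (k - 1) * (w t powr \<alpha> - w' t))) (at t)"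
      using pos[OF t] by (auto intro!: derivative_eq_intros DERIV_fun_powr deriv_w deriv_w' t)
    also have "a * (b * w t powr (b - 1) * w' t) * w' t ^ k
        + a * w t powr b * (real k * w' t ^ (k - 1) * (w t powr \<alpha> - w' t)) = ?g t"
      by (cases k) (simp_all add: powr_add algebra_simps)
    finally show ?thesis .
  qed
  then show ?case by (intro bexI[of _ ?g] diff_algebra.intros) auto
next
  case (sum f g)
  then obtain f' g' where "f' \<in> diff_algebra" "\<forall>t>0. (f has_real_derivative f' t) (at t)"
    "g' \<in> diff_algebra" "\<forall>t>0. (g has_real_derivative g' t) (at t)" by blast
  then show ?case
    by (intro bexI[of _ "\<lambda>t. f' t + g' t"] diff_algebra.sum) (auto intro: DERIV_add)
qed

lemma smooth:
  "\<exists>D. D 0 = w \<and> (\<forall>n. \<forall>t>0. (D n has_real_derivative D (Suc n) t) (at t))"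
proof -
  obtain d where d: "\<And>f. f \<in> diff_algebra \<Longrightarrow> d f \<in> diff_algebra"
    "\<And>f t. f \<in> diff_algebra \<Longrightarrow> 0 < t \<Longrightarrow> (f has_real_derivative d f t) (at t)"
    using diff_algebra_deriv by metis
  \<comment> \<open>\<open>D 0\<close> must be \<open>w\<close> itself, while
    \<open>w t powr 1\<close> agrees with \<open>w t\<close> only where \<open>w t\<close> is
    nonnegative; so the algebra is entered at the first derivative, and \<open>w t powr 0\<close> is
    \<open>1\<close> for positive \<open>t\<close>.\<close>
  define e where "e = (\<lambda>t. 1 * w t powr 0 * w' t ^ 1)"
  have e: "(d ^^ n) e \<in> diff_algebra" for n
    by (induction n) (simp_all add: d(1), simp only: e_def monomial)
  define D where "D n = (case n of 0 \<Rightarrow> w | Suc n \<Rightarrow> (d ^^ n) e)" for n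
  have "(D n has_real_derivative D (Suc n) t) (at t)" if t: "0 < t" for n t
  proof (cases n)
    case 0
    then show ?thesis using deriv_w[OF t] pos[OF t] by (simp add: D_def e_def)
  next
    case (Suc k)
    then show ?thesis using d(2)[OF e t] by (simp add: D_def)
  qed
  then show ?thesis by (intro exI[of _ D]) (simp add: D_def)
qed

text \<open>At \<open>0\<close> the locale provides no derivative; there \<open>w\<close> is
  recovered as the integral of the continuous \<open>w'\<close>.\<close>

lemma deriv_w_within:
  assumes "0 \<le> t" "S \<subseteq> {0..}"
  shows "(w has_real_derivative w' t) (at t within S)"
proof (cases "t = 0")
  case False
  then show ?thesis using assms deriv_w[of t] by (auto intro: has_field_derivative_at_within)
next
  case True
  have eq: "integral {0..s} w' = w s" if "0 \<le> s" for s
  proof -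
    have "(w' has_integral (w s - w 0)) {0..s}"
      using that deriv_w
      by (intro fundamental_theorem_of_calculus_interior cont_sub)
        (auto simp flip: has_real_derivative_iff_has_vector_derivative)
    then show ?thesis using at_0 by (simp add: integral_unique)
  qed
  have "((\<lambda>s. integral {0..s} w') has_real_derivative w' 0) (at 0 within {0..1})"
    by (intro integral_has_real_derivative cont_sub) auto
  then have "((\<lambda>s. integral {0..s} w') has_real_derivative w' 0) (at 0 within {0..})"
    by (subst at_within_nhd[of 0 "{..<1}" "{0..}" "{0..1::real}"]) auto
  then have "(w has_real_derivative w' 0) (at 0 within {0..})"
    by (rule has_field_derivative_transform_within[of _ _ _ _ 1]) (auto simp: eq)
  then show ?thesis using True assms by (auto intro: DERIV_subset)
qed

end

section \<open>The free boundary problem as a first-order system\<close>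

lemma Cinfty_within_cong:
  assumes "Cinfty_within S f" "\<And>x. x \<in> S \<Longrightarrow> f x = g x"
  shows "Cinfty_within S g"
proof -
  obtain D where D: "D 0 = f"
    "\<And>n x. x \<in> S \<Longrightarrow> (D n has_real_derivative D (Suc n) x) (at x within S)"
    using assms(1) by (auto simp: Cinfty_within_def)
  define E where "E = D(0 := g)"
  have "(E n has_real_derivative E (Suc n) x) (at x within S)" if "x \<in> S" for n x
  proof (cases n)
    case 0
    have "(g has_real_derivative D (Suc 0) x) (at x within S)"
      using D(2)[OF that, of 0] unfolding D(1)
      by (rule has_field_derivative_transform_within[where d = 1]) (use assms(2) that in auto)
    then show ?thesis using 0 by (simp add: E_def)
  qed (use D(2) that in \<open>simp add: E_def\<close>)
  then show ?thesis unfolding Cinfty_within_def by (intro exI[of _ E]) (simp add: E_def)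
qed

lemma deriv_cong_on_open:
  fixes f g :: "real \<Rightarrow> real"
  assumes "open S" "x \<in> S" "\<And>y. y \<in> S \<Longrightarrow> f y = g y"
  shows "deriv f x = deriv g x"
  using assms by (intro deriv_cong_ev) (auto simp: eventually_nhds)

text \<open>Allows a closed formula for a solution to be replaced by its extensional restriction,
  which is what \<open>fb_triple\<close> describes.\<close>

lemma fb_solution_cong:
  assumes v: "fb_solution \<alpha> \<Lambda> v0 c R v" and eq: "\<And>\<xi>. \<xi> \<in> {0..R} \<Longrightarrow> v \<xi> = u \<xi>"
  shows "fb_solution \<alpha> \<Lambda> v0 c R u"
proof -
  have R: "0 < R" using v by (simp add: fb_solution_def)
  have transfer: "(u has_real_derivative d) (at \<xi> within {0..R})"
    if "(v has_real_derivative d) (at \<xi> within {0..R})" "\<xi> \<in> {0..R}" for d \<xi>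
    using that(1)
    by (rule has_field_derivative_transform_within[where d = 1]) (use that(2) eq in auto)
  have d1: "deriv v \<xi> = deriv u \<xi>" if "\<xi> \<in> {0<..<R}" for \<xi>
    by (rule deriv_cong_on_open[of "{0<..<R}"]) (use that eq in auto)
  have d2: "deriv (deriv v) \<xi> = deriv (deriv u) \<xi>" if "\<xi> \<in> {0<..<R}" for \<xi>
    by (rule deriv_cong_on_open[of "{0<..<R}"]) (use that d1 in auto)
  have "Cinfty_within {0..<R} u"
    by (rule Cinfty_within_cong[of _ v]) (use v eq in \<open>auto simp: fb_solution_def\<close>)
  moreover have "C1_within {0..R} u"
  proof -
    obtain f' where "\<forall>x\<in>{0..R}. (v has_real_derivative f' x) (at x within {0..R})" "continuous_on {0..R} f'"
      using v by (auto simp: fb_solution_def C1_within_def)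
    then show ?thesis unfolding C1_within_def by (intro exI[of _ f']) (auto intro: transfer)
  qed
  moreover have "\<Lambda> * deriv (deriv u) \<xi> - c * deriv u \<xi> = u \<xi> powr \<alpha>" if "\<xi> \<in> {0<..<R}" for \<xi>
  proof -
    have "\<Lambda> * deriv (deriv v) \<xi> - c * deriv v \<xi> = v \<xi> powr \<alpha>" using v that by (auto simp: fb_solution_def)
    then show ?thesis using d1[OF that] d2[OF that] eq[of \<xi>] that by simp
  qed
  ultimately show ?thesis
    using v transfer[of _ 0] transfer[of _ R] eq[of 0] eq[of R] eq R
    unfolding fb_solution_def by fastforce
qed

text \<open>Smoothness makes \<open>deriv (deriv v)\<close> a genuine derivative, namely of the
  \<open>v'\<close> that the \<open>C1_within\<close> condition extends continuously to both end
  points.\<close>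

lemma fb_solution_system:
  assumes v: "fb_solution \<alpha> \<Lambda> v0 c R v" and "0 < \<Lambda>"
  obtains v' where "continuous_on {0..R} v" "continuous_on {0..R} v'"
    "v' 0 = - (c / \<Lambda>) * (1 - v0)" "v' R = 0"
    "\<forall>\<xi>\<in>{0<..<R}. (v has_real_derivative v' \<xi>) (at \<xi>) \<and>
      (v' has_real_derivative (v \<xi> powr \<alpha> + c * v' \<xi>) / \<Lambda>) (at \<xi>)"
proof -
  have R: "0 < R" using v by (simp add: fb_solution_def)
  obtain v' where v': "\<And>x. x \<in> {0..R} \<Longrightarrow> (v has_real_derivative v' x) (at x within {0..R})"
    and cont: "continuous_on {0..R} v'"
    using v unfolding fb_solution_def C1_within_def by blast
  obtain D where D: "D 0 = v"
    "\<And>n x. x \<in> {0..<R} \<Longrightarrow> (D n has_real_derivative D (Suc n) x) (at x within {0..<R})"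
    using v by (auto simp: fb_solution_def Cinfty_within_def)
  have nontrivial: "at x within {0..R} \<noteq> bot" if "x \<in> {0..R}" for x
    using R that by (simp add: trivial_limit_within islimpt_Icc)
  have unique: "a = b" if "(v has_real_derivative a) (at x within {0..R})"
    "(v has_real_derivative b) (at x within {0..R})" "x \<in> {0..R}" for a b x
    using that nontrivial[OF that(3)]
    by (auto simp: has_field_derivative_iff intro: tendsto_unique)
  have at: "at x within {0..R} = at x" "at x within {0..<R} = at x" if "0 < x" "x < R" for x
    using that by (auto intro!: at_within_interior)
  have d1: "(v has_real_derivative v' x) (at x)" if "0 < x" "x < R" for x
    using v'[of x] at[OF that] that by simp
  have eq: "v' x = D 1 x" "deriv v x = v' x" if "0 < x" "x < R" for x
    using d1[OF that] D(2)[of x 0] at[OF that] that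
    by (auto simp: D(1) intro: DERIV_unique DERIV_imp_deriv)
  show ?thesis
  proof (rule that[OF _ cont])
    show "continuous_on {0..R} v"
      by (auto simp: continuous_on_eq_continuous_within intro!: DERIV_continuous v')
    show "v' 0 = - (c / \<Lambda>) * (1 - v0)" "v' R = 0"
      using v R unique[OF v'[of 0]] unique[OF v'[of R]] by (auto simp: fb_solution_def)
    have "(v' has_real_derivative (v x powr \<alpha> + c * v' x) / \<Lambda>) (at x)" if x: "0 < x" "x < R" for x
    proof -
      have "(D 1 has_real_derivative D 2 x) (at x)"
        using D(2)[of x 1] at[OF x] x by (simp add: numeral_2_eq_2)
      then have v'': "(v' has_real_derivative D 2 x) (at x)"
        by (rule has_field_derivative_transform_within_open[where S = "{0<..<R}"])
          (use x eq in auto)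
      have "deriv (deriv v) x = deriv v' x"
        by (rule deriv_cong_on_open[of "{0<..<R}"]) (use x eq in auto)
      then have "deriv (deriv v) x = D 2 x" using DERIV_imp_deriv[OF v''] by simp
      moreover have "\<Lambda> * deriv (deriv v) x - c * deriv v x = v x powr \<alpha>"
        using v x by (auto simp: fb_solution_def)
      ultimately have "D 2 x = (v x powr \<alpha> + c * v' x) / \<Lambda>"
        using \<open>0 < \<Lambda>\<close> eq[OF x] by (simp add: field_simps)
      then show ?thesis using v'' by simp
    qed
    then show "\<forall>\<xi>\<in>{0<..<R}. (v has_real_derivative v' \<xi>) (at \<xi>) \<and>
      (v' has_real_derivative (v \<xi> powr \<alpha> + c * v' \<xi>) / \<Lambda>) (at \<xi>)" using d1 by simp
  qed
qed

section \<open>Solutions as rescaled profiles, and positivity before the free boundary\<close>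

context profile
begin

text \<open>\<open>barrier\<close> vanishes at \<open>0\<close> exactly to the order
  \<open>2 / (1 - \<alpha>)\<close>, and the integer exponent exceeds this by at least
  \<open>1\<close>.\<close>

lemma barrier_not_flat:
  assumes "0 < A" "0 < B" "0 < \<delta>"
  shows "\<exists>s\<in>{0<..<\<delta>}. C * s ^ nat \<lceil>2 / (1 - \<alpha>) + 1\<rceil> < A * barrier \<alpha> (B * s)"
proof (rule ccontr)
  assume contr: "\<not> ?thesis"
  define m K N where "m = 2 / (1 - \<alpha>)"
    and "K = ((1 - \<alpha>)\<^sup>2 / (2 * (1 + \<alpha>))) powr (1 / (1 - \<alpha>))" and "N = nat \<lceil>m + 1\<rceil>"
  have m: "0 < m" and K: "0 < K" using alpha by (auto simp: m_def K_def)
  have "A * K \<le> \<bar>C\<bar> * (s powr (m + 1) / (1 - exp (- (B * s))) powr m)" if s: "0 < s" "s < min 1 \<delta>" for s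
  proof -
    have "s ^ N = s powr real N" using s by (simp add: powr_realpow)
    also have "\<dots> \<le> s powr (m + 1)"
      using s by (intro powr_mono') (auto simp only: N_def real_nat_ceiling_ge)
    finally have "s ^ N \<le> s powr (m + 1)" .
    have "A * barrier \<alpha> (B * s) \<le> C * s ^ N"
      using contr s by (auto simp: N_def m_def not_less)
    also have "\<dots> \<le> \<bar>C\<bar> * s ^ N" using s by (intro mult_right_mono) auto
    also have "\<dots> \<le> \<bar>C\<bar> * s powr (m + 1)" using \<open>s ^ N \<le> _\<close> by (intro mult_left_mono) auto
    finally have "A * (K * (1 - exp (- (B * s))) powr m) \<le> \<bar>C\<bar> * s powr (m + 1)"
      by (simp add: barrier_def[OF alpha] K_def m_def)
    moreover have "0 < (1 - exp (- (B * s))) powr m" using s assms by simp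
    ultimately show ?thesis by (simp add: pos_le_divide_eq mult.assoc)
  qed
  then have "\<forall>\<^sub>F s in at_right 0. A * K \<le> \<bar>C\<bar> * (s powr (m + 1) / (1 - exp (- (B * s))) powr m)"
    using assms by (intro eventually_at_rightI[of _ "min 1 \<delta>"]) auto
  moreover have "((\<lambda>s. s powr (m + 1) / (1 - exp (- (B * s))) powr m) \<longlongrightarrow> 0) (at_right 0)"
    using m assms by real_asymp
  then have "((\<lambda>s. \<bar>C\<bar> * (s powr (m + 1) / (1 - exp (- (B * s))) powr m)) \<longlongrightarrow> \<bar>C\<bar> * 0) (at_right 0)"
    by (intro tendsto_intros)
  ultimately have "A * K \<le> \<bar>C\<bar> * 0" by (intro tendsto_lowerbound) auto
  then show False using K assms by (simp add: mult_le_0_iff)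
qed

text \<open>With \<open>B = c / \<Lambda>\<close> the amplitude \<open>A\<close> is determined by \<open>\<Lambda> B\<^sup>2 A = A powr \<alpha>\<close>;
  the two conditions turn the profile equation into the free boundary equation.\<close>

lemma rescaled_unique:
  assumes scale: "0 < \<Lambda>" "0 < A" "0 < B" "\<Lambda> * B\<^sup>2 * A = A powr \<alpha>" "c = \<Lambda> * B"
    and z: "0 < z" "z \<le> R"
    and cont: "continuous_on {0..R} v" "continuous_on {0..R} v'"
    and v: "\<And>\<xi>. 0 < \<xi> \<Longrightarrow> \<xi> < R \<Longrightarrow> (v has_real_derivative v' \<xi>) (at \<xi>)"
    and v': "\<And>\<xi>. 0 < \<xi> \<Longrightarrow> \<xi> < R \<Longrightarrow> (v' has_real_derivative (v \<xi> powr \<alpha> + c * v' \<xi>) / \<Lambda>) (at \<xi>)"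
    and nonneg_v: "\<And>\<xi>. 0 \<le> \<xi> \<Longrightarrow> \<xi> \<le> R \<Longrightarrow> 0 \<le> v \<xi>"
    and pos_v: "\<And>\<xi>. 0 < \<xi> \<Longrightarrow> \<xi> < z \<Longrightarrow> 0 < v \<xi>"
    and at_z: "v z = 0" "v' z = 0"
    and \<xi>: "0 \<le> \<xi>" "\<xi> \<le> z"
  shows "v \<xi> = A * w (B * (z - \<xi>)) \<and> v' \<xi> = - (A * B) * w' (B * (z - \<xi>))"
proof -
  \<comment> \<open>The end \<open>z\<close> of the reversed interval is \<open>R\<close> in
    \<open>fb_solution_unique\<close> and a hypothetical earlier zero in
    \<open>fb_solution_pos\<close>.\<close>
  define u p where "u t = v (z - t / B) / A" and "p t = - (v' (z - t / B) / (A * B))" for t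
  have "solves \<alpha> (B * z) u p"
    unfolding solves_def
  proof (intro conjI ballI)
    have sub: "z - t / B \<in> {0..R}" if "t \<in> {0..B * z}" for t
      using that scale z by (auto simp: pos_divide_le_eq mult.commute intro: order_trans[of _ z])
    have "continuous_on {0..B * z} (\<lambda>t. f (z - t / B))" if "continuous_on {0..R} f" for f :: "real \<Rightarrow> real"
      by (intro continuous_on_compose2[OF that] continuous_intros) (use sub scale in auto)
    from this[OF cont(1)] this[OF cont(2)]
    show "continuous_on {0..B * z} u" "continuous_on {0..B * z} p"
      unfolding u_def p_def using scale by (intro continuous_intros; simp)+
    show "0 \<le> u t" if "t \<in> {0..B * z}" for t
      using sub[OF that] scale nonneg_v[of "z - t / B"] by (simp add: u_def)
    fix t assume t: "t \<in> {0<..<B * z}"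
    then have x: "0 < z - t / B" "z - t / B < R" using scale z
      by (auto simp: pos_divide_less_eq mult.commute intro: less_le_trans[of _ z])
    have d: "((\<lambda>t. z - t / B) has_real_derivative - 1 / B) (at t)"
      using scale by (auto intro!: derivative_eq_intros)
    have "(u has_real_derivative (v' (z - t / B) * (- 1 / B)) / A) (at t)"
      unfolding u_def by (intro DERIV_cdivide DERIV_chain2[OF v[OF x] d])
    then show "(u has_real_derivative p t) (at t)" by (simp add: p_def mult.commute)
    have "(p has_real_derivative - (((v (z - t / B) powr \<alpha> + c * v' (z - t / B)) / \<Lambda> * (- 1 / B)) / (A * B))) (at t)"
      unfolding p_def by (intro DERIV_minus DERIV_cdivide DERIV_chain2[OF v'[OF x] d])
    moreover have "- (((v (z - t / B) powr \<alpha> + c * v' (z - t / B)) / \<Lambda> * (- 1 / B)) / (A * B))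
        = v (z - t / B) powr \<alpha> / (\<Lambda> * B\<^sup>2 * A) + v' (z - t / B) / (A * B)"
      using scale(1-3) unfolding scale(5) by (simp add: field_simps power2_eq_square)
    moreover have "v (z - t / B) powr \<alpha> / (\<Lambda> * B\<^sup>2 * A) = u t powr \<alpha>"
      using scale nonneg_v[of "z - t / B"] x by (simp add: u_def powr_divide)
    ultimately show "(p has_real_derivative u t powr \<alpha> - p t) (at t)" by (simp add: p_def)
  qed
  moreover have "u 0 = 0" "p 0 = 0" by (simp_all add: u_def p_def at_z)
  moreover have "0 < u t" if "0 < t" "t < B * z" for t
    using that scale pos_v[of "z - t / B"] by (simp add: u_def pos_divide_less_eq mult.commute)
  moreover have "0 \<le> B * (z - \<xi>)" "B * (z - \<xi>) \<le> B * z" using scale \<xi> by auto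
  ultimately have "u (B * (z - \<xi>)) = w (B * (z - \<xi>))" "p (B * (z - \<xi>)) = w' (B * (z - \<xi>))"
    by (auto intro!: unique)
  then show ?thesis using scale by (simp add: u_def p_def field_simps)
qed

lemma fb_solution_pos:
  assumes v: "fb_solution \<alpha> \<Lambda> v0 c R v" and "0 < \<Lambda>" "0 < v0"
    and scale: "0 < A" "0 < B" "\<Lambda> * B\<^sup>2 * A = A powr \<alpha>" "c = \<Lambda> * B"
    and \<xi>: "0 \<le> \<xi>" "\<xi> < R"
  shows "0 < v \<xi>"
proof (rule ccontr)
  \<comment> \<open>At a first zero \<open>z < R\<close> all derivatives of \<open>v\<close> vanish, whereas \<open>v \<xi>\<close> is of the exact order
    \<open>(z - \<xi>) powr (2 / (1 - \<alpha>))\<close> to the left of \<open>z\<close>.\<close>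
  assume "\<not> 0 < v \<xi>"
  obtain v' where cont: "continuous_on {0..R} v" "continuous_on {0..R} v'"
    and "v' 0 = - (c / \<Lambda>) * (1 - v0)" "v' R = 0"
    and "\<forall>\<xi>\<in>{0<..<R}. (v has_real_derivative v' \<xi>) (at \<xi>) \<and>
      (v' has_real_derivative (v \<xi> powr \<alpha> + c * v' \<xi>) / \<Lambda>) (at \<xi>)"
    by (rule fb_solution_system[OF v \<open>0 < \<Lambda>\<close>])
  then have v_d: "(v has_real_derivative v' x) (at x)"
    and v'_d: "(v' has_real_derivative (v x powr \<alpha> + c * v' x) / \<Lambda>) (at x)"
    if "0 < x" "x < R" for x using that by auto
  have nn: "0 \<le> v x" if "0 \<le> x" "x \<le> R" for x using v that by (auto simp: fb_solution_def)
  define S where "S = {x \<in> {0..R}. v x \<le> 0}"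
  have "closed S" unfolding S_def
    by (intro continuous_on_closed_Collect_le cont continuous_intros)
  have "\<xi> \<in> S" using \<xi> \<open>\<not> 0 < v \<xi>\<close> by (auto simp: S_def)
  have bdd: "bdd_below S" by (auto simp: S_def bdd_below_def)
  define z where "z = Inf S"
  have "z \<in> S" unfolding z_def using \<open>\<xi> \<in> S\<close> \<open>closed S\<close> bdd closed_contains_Inf by blast
  have "z \<le> \<xi>" unfolding z_def by (rule cInf_lower[OF \<open>\<xi> \<in> S\<close> bdd])
  then have z: "0 < z" "z < R" "v z = 0"
    using \<open>z \<in> S\<close> \<xi> nn[of z] v \<open>0 < v0\<close> by (auto simp: S_def fb_solution_def less_le)
  have before: "0 < v x" if "0 \<le> x" "x < z" for x
  proof (rule ccontr)
    assume "\<not> 0 < v x"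
    then have "x \<in> S" using that z by (auto simp: S_def)
    then show False using cInf_lower[OF _ bdd, of x] that by (simp add: z_def)
  qed
  \<comment> \<open>\<open>exp (- B * x) * v' x\<close> is nondecreasing and vanishes at
    \<open>R\<close>; hence \<open>v\<close> is nonincreasing and stays \<open>0\<close> once it has
    reached it.\<close>
  have v'_le: "v' x \<le> 0" if x: "0 < x" "x < R" for x
  proof -
    have "exp (- B * x) * v' x \<le> exp (- B * R) * v' R"
    proof (rule nondecreasing_from_derivative[where f = "\<lambda>x. exp (- B * x) * v' x"])
      show "continuous_on {x..R} (\<lambda>x. exp (- B * x) * v' x)"
        by (intro continuous_intros continuous_on_subset[OF cont(2)]) (use x in auto)
      fix y assume "x < y" "y < R"
      then have y: "0 < y" "y < R" using x by auto
      show "((\<lambda>x. exp (- B * x) * v' x) has_real_derivative exp (- B * y) * (v y powr \<alpha> / \<Lambda>)) (at y)"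
        using \<open>0 < \<Lambda>\<close> scale
        by (auto intro!: derivative_eq_intros v'_d[OF y] simp: field_simps)
      show "0 \<le> exp (- B * y) * (v y powr \<alpha> / \<Lambda>)" using \<open>0 < \<Lambda>\<close> by simp
    qed (use x in simp)
    then show ?thesis using \<open>v' R = 0\<close> by (simp add: mult_le_0_iff)
  qed
  have after: "v x = 0" if "z \<le> x" "x < R" for x
  proof -
    have "- v z \<le> - v x"
    proof (rule nondecreasing_from_derivative[where f = "\<lambda>x. - v x", OF that(1)])
      show "continuous_on {z..x} (\<lambda>x. - v x)"
        by (intro continuous_intros continuous_on_subset[OF cont(1)]) (use z that in auto)
      show "((\<lambda>x. - v x) has_real_derivative - v' y) (at y)" "0 \<le> - v' y" if "z < y" "y < x" for y
        using that \<open>x < R\<close> z v'_le[of y] by (auto intro!: DERIV_minus v_d)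
    qed
    then show ?thesis using nn[of x] that z by simp
  qed
  obtain D where D: "D 0 = v"
    "\<And>n x. x \<in> {0..<R} \<Longrightarrow> (D n has_real_derivative D (Suc n) x) (at x within {0..<R})"
    using v by (auto simp: fb_solution_def Cinfty_within_def)
  have D_at: "(D n has_real_derivative D (Suc n) x) (at x)" if "0 < x" "x < R" for n x
    using D(2)[of x n] that at_within_interior[of x "{0..<R}"] by simp
  have D_after: "D n x = 0" if "z < x" "x < R" for n x
    using that
  proof (induction n arbitrary: x)
    case 0
    then show ?case using after by (simp add: D(1))
  next
    case (Suc n)
    have "((\<lambda>_. 0) has_real_derivative D (Suc n) x) (at x)"
    proof (rule has_field_derivative_transform_within_open[where S = "{z<..<R}"])
      show "(D n has_real_derivative D (Suc n) x) (at x)" using D_at[of x n] Suc.prems z by simp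
    qed (use Suc in auto)
    then show ?case using DERIV_const DERIV_unique by blast
  qed
  have D_z: "D n z = 0" for n
  proof -
    have "isCont (D n) z" using D_at[OF z(1,2)] by (rule DERIV_isCont)
    then have "(D n \<longlongrightarrow> D n z) (at_right z)" by (simp add: isCont_def filterlim_at_split)
    moreover have "\<forall>\<^sub>F x in at_right z. D n x = 0"
      by (rule eventually_at_rightI[of z R]) (use D_after z in auto)
    then have "(D n \<longlongrightarrow> 0) (at_right z)" by (rule tendsto_eventually)
    ultimately show ?thesis by (rule tendsto_unique[rotated]) simp
  qed
  have "v' z = D 1 z" using v_d[of z] D_at[of z 0] z by (auto simp: D(1) intro: DERIV_unique)
  then have "v' z = 0" by (simp add: D_z)
  define N where "N = nat \<lceil>2 / (1 - \<alpha>) + 1\<rceil>"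
  have "continuous_on {z / 2..z} (D N)"
    using z by (intro continuous_at_imp_continuous_on ballI DERIV_isCont[OF D_at]) auto
  then obtain C where C: "\<And>x. x \<in> {z / 2..z} \<Longrightarrow> \<bar>D N x\<bar> \<le> C"
    using compact_continuous_image[of "{z / 2..z}" "D N"] compact_imp_bounded bounded_iff
    by (metis compact_Icc image_eqI real_norm_def)
  \<comment> \<open>Taylor's formula at \<open>z\<close>, where every lower coefficient
    vanishes.\<close>
  have flat: "v (z - s) \<le> C * s ^ N" if s: "0 < s" "s < z / 2" for s
  proof -
    have "0 < 2 / (1 - \<alpha>)" using alpha by simp
    then have "0 < 2 / (1 - \<alpha>) + 1" by linarith
    then have "0 < N" unfolding N_def by simp
    then have "\<exists>t. z - s < t \<and> t < z \<and>
      v (z - s) = (\<Sum>m<N. D m z / fact m * (z - s - z) ^ m) + D N t / fact N * (z - s - z) ^ N"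
      using s z by (intro Taylor_down[of N D v "z - s" z z]) (auto simp: D(1) D_at)
    then obtain t where t: "z - s < t" "t < z" "v (z - s) = D N t / fact N * (- s) ^ N"
      by (auto simp: D_z)
    have "v (z - s) \<le> \<bar>D N t / fact N * (- s) ^ N\<bar>" unfolding t(3) by (rule abs_ge_self)
    also have "\<dots> = \<bar>D N t\<bar> / fact N * s ^ N" using s by (simp add: abs_mult power_abs)
    also have "\<dots> \<le> C / 1 * s ^ N"
      using s t C[of t] by (intro mult_right_mono frac_le fact_ge_1) auto
    finally show ?thesis by simp
  qed
  obtain s where s: "s \<in> {0<..<z / 2}" "C * s ^ N < A * barrier \<alpha> (B * s)"
    using barrier_not_flat[of A B "z / 2" C] scale z unfolding N_def by auto
  \<comment> \<open>Left of \<open>z\<close> the function is a rescaled profile, hence bounded below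
    by the rescaled barrier.\<close>
  have "v (z - s) = A * w (B * (z - (z - s)))"
    using rescaled_unique[OF \<open>0 < \<Lambda>\<close> scale z(1) less_imp_le[OF z(2)] cont v_d v'_d nn _ z(3) \<open>v' z = 0\<close>, of "z - s"]
      before s by auto
  then have "A * barrier \<alpha> (B * s) \<le> v (z - s)"
    using lower[of "B * s"] scale s by simp
  then show False using s flat[of s] by simp
qed

end

section \<open>Parametrisation of the free boundary problem by the profile\<close>

lemma scale_exists:
  fixes \<alpha> \<Lambda> c :: real
  assumes "\<alpha> < 1" "0 < \<Lambda>" "0 < c"
  obtains A where "0 < A" "\<Lambda> * (c / \<Lambda>)\<^sup>2 * A = A powr \<alpha>"
proof
  \<comment> \<open>Solves \<open>A powr (1 - \<alpha>) = \<Lambda> / c\<^sup>2\<close>, the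
    required relation divided by \<open>A powr \<alpha>\<close>.\<close>
  let ?A = "(\<Lambda> / c\<^sup>2) powr (1 / (1 - \<alpha>))"
  show "0 < ?A" using assms by simp
  then have "?A = ?A powr (1 - \<alpha>) * ?A powr \<alpha>" by (simp only: flip: powr_add) simp
  also have "?A powr (1 - \<alpha>) = \<Lambda> / c\<^sup>2" using assms by (simp add: powr_powr)
  finally have "?A * (c\<^sup>2 / \<Lambda>) = (\<Lambda> / c\<^sup>2 * ?A powr \<alpha>) * (c\<^sup>2 / \<Lambda>)"
    by (rule arg_cong[where f = "\<lambda>x. x * (c\<^sup>2 / \<Lambda>)"])
  then show "\<Lambda> * (c / \<Lambda>)\<^sup>2 * ?A = ?A powr \<alpha>"
    using assms by (simp add: power2_eq_square power_divide mult.commute)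
qed

text \<open>The uniqueness proof finds an amplitude from the speed, the parametrisation a speed from
  the amplitude; this is the bridge.\<close>

lemma scale_iff:
  fixes A \<alpha> \<Lambda> c :: real
  assumes "0 < A" "0 < \<Lambda>" "0 < c"
  shows "\<Lambda> * (c / \<Lambda>)\<^sup>2 * A = A powr \<alpha> \<longleftrightarrow> c = sqrt (\<Lambda> * A powr (\<alpha> - 1))"
proof -
  have powr: "A powr (\<alpha> - 1) = A powr \<alpha> / A" using assms by (simp add: powr_diff)
  have "c = sqrt (\<Lambda> * A powr (\<alpha> - 1)) \<longleftrightarrow> c\<^sup>2 = \<Lambda> * A powr (\<alpha> - 1)"
    using assms by (auto simp: real_sqrt_unique)
  moreover have "c\<^sup>2 = \<Lambda> * (A powr \<alpha> / A) \<longleftrightarrow> \<Lambda> * (c / \<Lambda>)\<^sup>2 * A = A powr \<alpha>"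
    using assms by (simp add: field_simps power2_eq_square)
  ultimately show ?thesis unfolding powr by blast
qed

context profile
begin

text \<open>The hypothesis \<open>A * (w (B * R) + w' (B * R)) = 1\<close> is the condition on
  \<open>v' 0\<close> divided by \<open>- B\<close>. The point \<open>R\<close> corresponds to the
  time \<open>0\<close> of the profile, about which \<open>smooth\<close> says nothing; this matches
  \<open>{0..<R}\<close>.\<close>

lemma rescaled_fb_solution:
  assumes scale: "0 < \<Lambda>" "0 < A" "0 < B" "\<Lambda> * B\<^sup>2 * A = A powr \<alpha>" "c = \<Lambda> * B"
    and T: "0 < R" "A * (w (B * R) + w' (B * R)) = 1"
  shows "fb_solution \<alpha> \<Lambda> (A * w (B * R)) c R (\<lambda>\<xi>. A * w (B * (R - \<xi>)))" (is "fb_solution _ _ _ _ _ ?v")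
proof -
  define v' where "v' = (\<lambda>\<xi>. - (A * B) * w' (B * (R - \<xi>)))"
  have d: "((\<lambda>\<xi>. B * (R - \<xi>)) has_real_derivative - B) (at x within S)" for x S
    by (auto intro!: derivative_eq_intros)
  have v': "(?v has_real_derivative v' x) (at x within {0..R})" if "x \<in> {0..R}" for x
  proof -
    have "(w has_real_derivative w' (B * (R - x))) (at (B * (R - x)) within (\<lambda>\<xi>. B * (R - \<xi>)) ` {0..R})"
      by (rule deriv_w_within) (use scale that in auto)
    from DERIV_cmult[OF DERIV_image_chain[OF this d], of A] show ?thesis
      by (simp add: v'_def o_def ac_simps)
  qed
  have cont_v': "continuous_on {0..R} v'"
    unfolding v'_def using scale
    by (intro continuous_intros continuous_on_compose2[OF cont(2)]) auto
  have dv: "deriv ?v x = v' x" if "x \<in> {0<..<R}" for x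
    using v'[of x] that at_within_interior[of x "{0..R}"] by (auto intro: DERIV_imp_deriv)
  have ddv: "deriv (deriv ?v) x = A * B\<^sup>2 * (w (B * (R - x)) powr \<alpha> - w' (B * (R - x)))"
    if "x \<in> {0<..<R}" for x
  proof -
    have "(v' has_real_derivative - (A * B) * ((w (B * (R - x)) powr \<alpha> - w' (B * (R - x))) * - B)) (at x)"
      unfolding v'_def using that scale
      by (intro DERIV_cmult DERIV_chain2[OF deriv_w' d]) auto
    then have "deriv v' x = A * B\<^sup>2 * (w (B * (R - x)) powr \<alpha> - w' (B * (R - x)))"
      by (subst DERIV_imp_deriv) (auto simp: power2_eq_square ac_simps)
    moreover have "deriv (deriv ?v) x = deriv v' x"
      by (rule deriv_cong_on_open[of "{0<..<R}"]) (use that dv in auto)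
    ultimately show ?thesis by simp
  qed
  show ?thesis
    unfolding fb_solution_def
  proof (intro conjI ballI)
    show "0 < c" "0 < R" using scale T by auto
    show "0 \<le> ?v x" if "x \<in> {0..R}" for x
      using that scale by (auto intro!: mult_nonneg_nonneg nonneg)
    show "C1_within {0..R} ?v"
      unfolding C1_within_def using v' cont_v' by blast
    obtain D where D: "D 0 = w" "\<And>n t. 0 < t \<Longrightarrow> (D n has_real_derivative D (Suc n) t) (at t)"
      using smooth by metis
    define E where "E n \<xi> = A * (- B) ^ n * D n (B * (R - \<xi>))" for n \<xi>
    have "(E n has_real_derivative E (Suc n) x) (at x within {0..<R})" if "x \<in> {0..<R}" for n x
    proof -
      have "(E n has_real_derivative A * (- B) ^ n * (D (Suc n) (B * (R - x)) * - B)) (at x within {0..<R})"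
        unfolding E_def using that scale by (intro DERIV_cmult DERIV_chain2[OF D(2) d]) auto
      then show ?thesis by (simp add: E_def ac_simps)
    qed
    moreover have "E 0 = ?v" by (simp add: E_def D fun_eq_iff)
    ultimately show "Cinfty_within {0..<R} ?v" unfolding Cinfty_within_def by blast
    show "\<Lambda> * deriv (deriv ?v) x - c * deriv ?v x = ?v x powr \<alpha>" if "x \<in> {0<..<R}" for x
    proof -
      have "\<Lambda> * deriv (deriv ?v) x - c * deriv ?v x
          = (\<Lambda> * B\<^sup>2 * A) * (w (B * (R - x)) powr \<alpha> - w' (B * (R - x))) + \<Lambda> * B * A * B * w' (B * (R - x))"
        unfolding ddv[OF that] dv[OF that] scale(5) v'_def by (simp add: algebra_simps)
      also have "\<dots> = (\<Lambda> * B\<^sup>2 * A) * w (B * (R - x)) powr \<alpha>"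
        by (simp add: algebra_simps power2_eq_square)
      also have "\<dots> = ?v x powr \<alpha>"
        using that scale nonneg[of "B * (R - x)"] by (simp add: scale(4) powr_mult)
      finally show ?thesis .
    qed
    have "v' 0 = - (B * (A * w' (B * R)))" by (simp add: v'_def)
    also have "A * w' (B * R) = 1 - A * w (B * R)" using T by (simp add: algebra_simps)
    finally show "(?v has_real_derivative - (c / \<Lambda>) * (1 - A * w (B * R))) (at 0 within {0..R})"
      using v'[of 0] T scale by simp
    show "(?v has_real_derivative 0) (at R within {0..R})"
      using v'[of R] T by (simp add: v'_def at_0)
  qed (simp_all add: at_0)
qed

text \<open>The solutions of the free boundary problem are parametrised by the rescaled length
  \<open>T = c R / \<Lambda>\<close>; \<open>height T\<close> is the corresponding value \<open>v 0\<close>.\<close>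

definition amplitude :: "real \<Rightarrow> real" where
  "amplitude T = 1 / (w T + w' T)"

definition height :: "real \<Rightarrow> real" where
  "height T = amplitude T * w T"

text \<open>The speed belonging to the amplitude by \<open>scale_iff\<close>; \<open>len\<close>
  then follows from \<open>T = c * R / \<Lambda>\<close>.\<close>

definition speed :: "real \<Rightarrow> real \<Rightarrow> real" where
  "speed \<Lambda> T = sqrt (\<Lambda> * amplitude T powr (\<alpha> - 1))"

definition len :: "real \<Rightarrow> real \<Rightarrow> real" where
  "len \<Lambda> T = \<Lambda> * T / speed \<Lambda> T"

lemma amplitude_pos: "0 < T \<Longrightarrow> 0 < amplitude T"
  by (simp add: amplitude_def pos pos' add_pos_pos)

lemma speed_pos: "0 < \<Lambda> \<Longrightarrow> 0 < T \<Longrightarrow> 0 < speed \<Lambda> T"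
  using amplitude_pos[of T] by (simp add: speed_def)

lemma len_pos: "0 < \<Lambda> \<Longrightarrow> 0 < T \<Longrightarrow> 0 < len \<Lambda> T"
  by (simp add: len_def speed_pos)

lemma speed_len:
  assumes "0 < \<Lambda>" "0 < T"
  shows "speed \<Lambda> T / \<Lambda> * len \<Lambda> T = T" "speed \<Lambda> T * len \<Lambda> T = \<Lambda> * T"
  using speed_pos[OF assms] assms by (simp_all add: len_def)

lemma height_eq:
  assumes "0 < T" shows "height T = 1 / (1 + slope T)"
  using pos[OF assms] pos'[OF assms] by (simp add: height_def amplitude_def slope_def field_simps)

lemma height_bounds: "0 < T \<Longrightarrow> 0 < height T \<and> height T < 1"
  using slope_pos[of T] by (simp add: height_eq)

lemma height_surj:
  assumes "0 < h" "h < 1" obtains T where "0 < T" "height T = h"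
proof -
  obtain T where T: "0 < T" "slope T = 1 / h - 1" using slope_surj[of "1 / h - 1"] assms by auto
  then show ?thesis using that[of T] by (simp add: height_eq)
qed

lemma amplitude_sum: "0 < T \<Longrightarrow> amplitude T * (w T + w' T) = 1"
  using add_pos_pos[OF pos[of T] pos'[of T]] by (simp add: amplitude_def)

text \<open>Whatever its speed, \<open>v\<close> is a rescaled profile, by positivity before
  \<open>R\<close>. The data at \<open>0\<close> then fix \<open>slope (B * R)\<close>, so
  \<open>B * R = T\<close> by injectivity, and amplitude, speed and length follow in this
  order.\<close>

lemma fb_solution_unique:
  assumes v: "fb_solution \<alpha> \<Lambda> (height T) c R v" and T: "0 < \<Lambda>" "0 < T"
  shows "c = speed \<Lambda> T" "R = len \<Lambda> T"
    "\<And>\<xi>. \<xi> \<in> {0..R} \<Longrightarrow> v \<xi> = amplitude T * w (speed \<Lambda> T / \<Lambda> * (len \<Lambda> T - \<xi>))"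
proof -
  have c: "0 < c" and R: "0 < R" "v 0 = height T" "v R = 0" using v by (auto simp: fb_solution_def)
  have nn: "0 \<le> v x" if "0 \<le> x" "x \<le> R" for x using v that by (auto simp: fb_solution_def)
  obtain A where A: "0 < A" "\<Lambda> * (c / \<Lambda>)\<^sup>2 * A = A powr \<alpha>"
    using scale_exists alpha T c by blast
  define B where "B = c / \<Lambda>"
  have B: "0 < B" "\<Lambda> * B\<^sup>2 * A = A powr \<alpha>" "c = \<Lambda> * B"
    using A T c by (simp_all add: B_def)
  obtain v' where cont: "continuous_on {0..R} v" "continuous_on {0..R} v'"
    and v'_0: "v' 0 = - (c / \<Lambda>) * (1 - height T)" and v'_R: "v' R = 0"
    and d: "\<forall>\<xi>\<in>{0<..<R}. (v has_real_derivative v' \<xi>) (at \<xi>) \<and>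
      (v' has_real_derivative (v \<xi> powr \<alpha> + c * v' \<xi>) / \<Lambda>) (at \<xi>)"
    by (rule fb_solution_system[OF v T(1)])
  have eq: "v \<xi> = A * w (B * (R - \<xi>)) \<and> v' \<xi> = - (A * B) * w' (B * (R - \<xi>))"
    if "0 \<le> \<xi>" "\<xi> \<le> R" for \<xi>
    by (rule rescaled_unique[OF T(1) A(1) B R(1) order_refl cont _ _ nn _ R(3) v'_R that])
      (use d fb_solution_pos[OF v T(1) _ A(1) B] height_bounds[OF T(2)] in auto)
  have "A * w (B * R) = height T" "B * (A * w' (B * R)) = B * (1 - height T)"
    using eq[of 0] R v'_0 B_def by auto
  then have *: "A * w (B * R) = height T" "A * w' (B * R) = 1 - height T"
    using B by auto
  have BR: "0 < B * R" using B R by simp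
  have "slope (B * R) = (A * w' (B * R)) / (A * w (B * R))"
    using A by (simp add: slope_def)
  also have "\<dots> = slope T"
    unfolding * using slope_pos[OF T(2)] by (simp add: height_eq T field_simps)
  finally have "B * R = T" using slope_inj BR T by blast
  then have "A * (w T + w' T) = 1" using * by (simp add: algebra_simps)
  then have "A = amplitude T"
    using add_pos_pos[OF pos[OF T(2)] pos'[OF T(2)]] by (simp add: amplitude_def eq_divide_eq)
  then show c_eq: "c = speed \<Lambda> T"
    using A c T by (simp add: scale_iff speed_def)
  show R_eq: "R = len \<Lambda> T"
    using \<open>B * R = T\<close> T c by (auto simp: len_def B_def c_eq[symmetric])
  show "v \<xi> = amplitude T * w (speed \<Lambda> T / \<Lambda> * (len \<Lambda> T - \<xi>))" if "\<xi> \<in> {0..R}" for \<xi>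
    using eq[of \<xi>] that unfolding \<open>A = amplitude T\<close> B_def c_eq R_eq by auto
qed

definition front :: "real \<Rightarrow> real \<Rightarrow> real \<Rightarrow> real" where
  "front \<Lambda> T = (\<lambda>\<xi>\<in>{0..len \<Lambda> T}. amplitude T * w (speed \<Lambda> T / \<Lambda> * (len \<Lambda> T - \<xi>)))"

lemma fb_solution_front:
  assumes "0 < \<Lambda>" "0 < T"
  shows "fb_solution \<alpha> \<Lambda> (height T) (speed \<Lambda> T) (len \<Lambda> T) (front \<Lambda> T)"
proof -
  let ?B = "speed \<Lambda> T / \<Lambda>"
  have "\<Lambda> * ?B\<^sup>2 * amplitude T = amplitude T powr \<alpha>"
    using assms amplitude_pos speed_pos by (subst scale_iff) (auto simp: speed_def)
  then have "fb_solution \<alpha> \<Lambda> (amplitude T * w (?B * len \<Lambda> T)) (speed \<Lambda> T) (len \<Lambda> T)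
      (\<lambda>\<xi>. amplitude T * w (?B * (len \<Lambda> T - \<xi>)))"
    using assms by (intro rescaled_fb_solution) (auto simp: speed_len amplitude_pos speed_pos len_pos amplitude_sum)
  then show ?thesis
    unfolding speed_len(1)[OF assms] height_def[symmetric]
    by (rule fb_solution_cong) (simp add: front_def)
qed

lemma fb_triple_eq:
  assumes "0 < \<Lambda>" "0 < T"
  shows "fb_triple \<alpha> \<Lambda> (height T) = (speed \<Lambda> T, len \<Lambda> T, front \<Lambda> T)"
  unfolding fb_triple_def
proof (rule the_equality)
  show "case (speed \<Lambda> T, len \<Lambda> T, front \<Lambda> T) of
      (c, R, v) \<Rightarrow> fb_solution \<alpha> \<Lambda> (height T) c R v \<and> v \<in> extensional {0..R}"
    using fb_solution_front[OF assms] by (simp add: front_def)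
next
  fix p :: "real \<times> real \<times> (real \<Rightarrow> real)"
  assume "case p of (c, R, v) \<Rightarrow> fb_solution \<alpha> \<Lambda> (height T) c R v \<and> v \<in> extensional {0..R}"
  then obtain c R v where p: "p = (c, R, v)" "fb_solution \<alpha> \<Lambda> (height T) c R v" "v \<in> extensional {0..R}"
    by (cases p) auto
  note u = fb_solution_unique[OF p(2) assms]
  have "v = front \<Lambda> T"
    using p(3) u by (intro extensionalityI[of _ "{0..R}"]) (auto simp: front_def)
  then show "p = (speed \<Lambda> T, len \<Lambda> T, front \<Lambda> T)" using p(1) u by simp
qed

text \<open>The term \<open>c \<integral> exp (- c s) v s ds\<close> of \<^const>\<open>Psi\<close> in the profile variable \<open>t = c (R - s) / \<Lambda>\<close>.\<close>

definition weight :: "real \<Rightarrow> real \<Rightarrow> real" where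
  "weight \<Lambda> T = \<Lambda> * amplitude T * exp (- \<Lambda> * T) * integral {0..T} (\<lambda>t. exp (\<Lambda> * t) * w t)"

lemma exp_w_continuous: "continuous_on {0..} (\<lambda>t. exp (\<Lambda> * t) * w t)"
  by (intro continuous_intros cont_sub) auto

lemma speed_times_integral_front:
  assumes "0 < \<Lambda>" "0 < T"
  shows "(\<lambda>s. exp (- speed \<Lambda> T * s) * front \<Lambda> T s) integrable_on {0..len \<Lambda> T}"
    and "speed \<Lambda> T * integral {0..len \<Lambda> T} (\<lambda>s. exp (- speed \<Lambda> T * s) * front \<Lambda> T s) = weight \<Lambda> T"
proof -
  define c R B where "c = speed \<Lambda> T" and "R = len \<Lambda> T" and "B = c / \<Lambda>"
  have pos_c: "0 < c" "0 < R" "0 < B" using assms by (simp_all add: c_def R_def B_def speed_pos len_pos)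
  have BR: "B * R = T" using speed_len[OF assms] by (simp add: c_def R_def B_def)
  have \<Lambda>B: "\<Lambda> * B = c" using assms by (simp add: B_def)
  let ?g = "\<lambda>t. exp (\<Lambda> * t) * w t"
  \<comment> \<open>Antiderivative obtained from \<open>t = B * (R - s)\<close>, where
    \<open>exp (- c * s) = exp (- c * R) * exp (\<Lambda> * t)\<close>.\<close>
  define F where "F s = - (amplitude T * exp (- c * R) / B) * integral {0..B * (R - s)} ?g" for s
  have "((\<lambda>s. exp (- c * s) * front \<Lambda> T s) has_integral (F R - F 0)) {0..R}"
  proof (rule fundamental_theorem_of_calculus_interior)
    show "continuous_on {0..R} F"
      unfolding F_def using pos_c
      by (intro continuous_intros continuous_on_compose2[OF integral_from_0_continuous[of ?g]]
          integrable_continuous_interval continuous_on_subset[OF exp_w_continuous]) auto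
    fix s assume s: "s \<in> {0<..<R}"
    have d: "((\<lambda>s. B * (R - s)) has_real_derivative - B) (at s)"
      by (auto intro!: derivative_eq_intros)
    have "(F has_real_derivative - (amplitude T * exp (- c * R) / B) * (?g (B * (R - s)) * - B)) (at s)"
      unfolding F_def using s pos_c
      by (intro DERIV_cmult DERIV_chain2[OF integral_from_0_has_derivative[OF exp_w_continuous] d]) auto
    also have "- (amplitude T * exp (- c * R) / B) * (?g (B * (R - s)) * - B)
        = exp (- c * R) * exp (c * (R - s)) * (amplitude T * w (B * (R - s)))"
      using pos_c by (simp add: mult.assoc[symmetric] \<Lambda>B)
    also have "exp (- c * R) * exp (c * (R - s)) = exp (- c * s)"
      by (simp add: algebra_simps flip: exp_add)
    also have "amplitude T * w (B * (R - s)) = front \<Lambda> T s"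
      using s by (simp add: front_def B_def c_def R_def)
    finally show "(F has_vector_derivative exp (- c * s) * front \<Lambda> T s) (at s)"
      by (simp add: has_real_derivative_iff_has_vector_derivative)
  qed (use pos_c in simp)
  then show "(\<lambda>s. exp (- speed \<Lambda> T * s) * front \<Lambda> T s) integrable_on {0..len \<Lambda> T}"
    and "speed \<Lambda> T * integral {0..len \<Lambda> T} (\<lambda>s. exp (- speed \<Lambda> T * s) * front \<Lambda> T s) = weight \<Lambda> T"
    unfolding c_def[symmetric] R_def[symmetric]
    using pos_c assms BR
    by (auto simp: integral_unique F_def weight_def \<Lambda>B[symmetric] mult.assoc)
qed

lemma weight_continuous:
  assumes "S \<subseteq> {0<..}"
  shows "continuous_on S (weight \<Lambda>)"
proof -
  have "continuous_on S (\<lambda>T. integral {0..T} (\<lambda>t. exp (\<Lambda> * t) * w t))"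
    by (rule continuous_on_subset[OF integral_from_0_continuous])
      (use assms in \<open>auto intro!: integrable_continuous_interval continuous_on_subset[OF exp_w_continuous]\<close>)
  moreover have "continuous_on S amplitude"
    unfolding amplitude_def using assms pos pos'
    by (intro continuous_intros cont_sub) (auto simp: subset_iff less_imp_le add_pos_pos less_imp_neq[symmetric])
  ultimately show ?thesis unfolding weight_def by (intro continuous_intros)
qed

lemma height_continuous: "S \<subseteq> {0<..} \<Longrightarrow> continuous_on S height"
proof -
  assume S: "S \<subseteq> {0<..}"
  have "continuous_on S (\<lambda>T. 1 / (1 + slope T))"
    using S slope_pos by (intro continuous_intros slope_continuous) (force simp: add_pos_pos)+
  then show ?thesis by (rule continuous_on_eq) (use S height_eq in auto)
qed

text \<open>Since \<open>w' > 0\<close>, integration by parts gives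
  \<open>\<Lambda> * ?I T \<le> exp (\<Lambda> * T) * w T\<close>, which bounds
  \<open>weight\<close> by \<open>height\<close>.\<close>

lemma weight_bounds:
  assumes "0 < \<Lambda>" "0 < T"
  shows "0 \<le> weight \<Lambda> T" "weight \<Lambda> T \<le> 1"
proof -
  let ?I = "\<lambda>T. integral {0..T} (\<lambda>t. exp (\<Lambda> * t) * w t)"
  have "0 \<le> ?I T"
    by (intro integral_nonneg integrable_continuous_interval continuous_on_subset[OF exp_w_continuous])
      (auto simp: nonneg)
  then show "0 \<le> weight \<Lambda> T" using assms amplitude_pos[of T] by (simp add: weight_def)
  have "exp (\<Lambda> * 0) * w 0 - \<Lambda> * ?I 0 \<le> exp (\<Lambda> * T) * w T - \<Lambda> * ?I T"
  proof (rule nondecreasing_from_derivative[where f = "\<lambda>t. exp (\<Lambda> * t) * w t - \<Lambda> * ?I t"])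
    show "continuous_on {0..T} (\<lambda>t. exp (\<Lambda> * t) * w t - \<Lambda> * ?I t)"
      by (intro continuous_intros cont_sub indefinite_integral_continuous_1 integrable_continuous_interval) auto
    fix t :: real assume t: "0 < t"
    show "((\<lambda>t. exp (\<Lambda> * t) * w t - \<Lambda> * ?I t) has_real_derivative exp (\<Lambda> * t) * w' t) (at t)"
    proof -
      have "((\<lambda>t. exp (\<Lambda> * t)) has_real_derivative exp (\<Lambda> * t) * \<Lambda>) (at t)"
        by (auto intro!: derivative_eq_intros)
      from DERIV_diff[OF DERIV_mult[OF this deriv_w[OF t]]
          DERIV_cmult[OF integral_from_0_has_derivative[OF exp_w_continuous[of \<Lambda>] t], of \<Lambda>]]
      show ?thesis by (simp add: ac_simps)
    qed
    show "0 \<le> exp (\<Lambda> * t) * w' t" using pos'[OF t] by simp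
  qed (use assms in simp)
  then have "\<Lambda> * ?I T \<le> exp (\<Lambda> * T) * w T" by (simp add: at_0)
  then have "amplitude T * exp (- \<Lambda> * T) * (\<Lambda> * ?I T)
      \<le> amplitude T * exp (- \<Lambda> * T) * (exp (\<Lambda> * T) * w T)"
    using amplitude_pos[OF assms(2)] by (intro mult_left_mono) auto
  also have "\<dots> = height T" by (simp add: height_def mult.assoc[symmetric] exp_minus)
  also have "\<dots> \<le> 1" using height_bounds[OF assms(2)] by simp
  finally show "weight \<Lambda> T \<le> 1" by (simp add: weight_def ac_simps)
qed

text \<open>Both end points of \<open>I\<close> are heights; \<open>weight \<ge> 0\<close> at the
  lower one and \<open>weight \<le> 1\<close> at the upper one give the two inequalities for the
  intermediate value theorem.\<close>

lemma fixed_height: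
  assumes "0 < \<theta>" "\<theta> < 1" "1 < \<Lambda>"
  obtains T where "0 < T" "\<Lambda> * height T = 1 - \<theta> + (\<Lambda> - 1) * weight \<Lambda> T"
proof -
  let ?h = "\<lambda>T. \<Lambda> * height T - (\<Lambda> - 1) * weight \<Lambda> T"
  obtain a where a: "0 < a" "height a = (1 - \<theta>) / \<Lambda>"
    using height_surj[of "(1 - \<theta>) / \<Lambda>"] assms by (auto simp: divide_less_eq)
  obtain b where b: "0 < b" "height b = 1 - \<theta> / \<Lambda>"
    using height_surj[of "1 - \<theta> / \<Lambda>"] assms by (auto simp: divide_less_eq)
  \<comment> \<open>\<open>height\<close> increases because \<open>slope\<close> decreases, so
    \<open>a\<close> and \<open>b\<close> are ordered like their heights.\<close>
  have "(1 - \<theta>) / \<Lambda> < 1 - \<theta> / \<Lambda>" using assms by (simp add: field_simps)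
  then have "1 / (1 + slope a) < 1 / (1 + slope b)" using a b by (simp flip: height_eq)
  then have "slope b < slope a"
    using slope_pos[OF a(1)] slope_pos[OF b(1)] by (simp add: field_simps)
  then have "a \<le> b" using slope_strict_antimono[OF b(1), of a] by fastforce
  have sub: "{a..b} \<subseteq> {0<..}" using a by auto
  have "\<Lambda> * height a = 1 - \<theta>" "\<Lambda> * height b = \<Lambda> - \<theta>"
    using a b assms by (simp_all add: field_simps)
  moreover have "0 \<le> (\<Lambda> - 1) * weight \<Lambda> a" "(\<Lambda> - 1) * weight \<Lambda> b \<le> (\<Lambda> - 1) * 1"
    using assms a b weight_bounds[of \<Lambda>] by (auto intro!: mult_left_mono mult_nonneg_nonneg)
  ultimately have "?h a \<le> 1 - \<theta>" "1 - \<theta> \<le> ?h b" by auto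
  moreover have "continuous_on {a..b} ?h"
    by (intro continuous_intros height_continuous weight_continuous sub)
  ultimately obtain T where "a \<le> T" "?h T = 1 - \<theta>"
    using IVT'[of ?h a "1 - \<theta>" b] \<open>a \<le> b\<close> by blast
  then show ?thesis using that[of T] a by simp
qed

end

text \<open>Fundamental theorem of calculus for \<open>exp (- c * s) * v s\<close>, whose boundary
  term at \<open>R\<close> vanishes.\<close>

lemma integral_exp_deriv_by_parts:
  assumes v: "fb_solution \<alpha> \<Lambda> v0 c R v" and "0 < \<Lambda>"
    and int: "(\<lambda>s. exp (- c * s) * v s) integrable_on {0..R}"
  shows "integral {0..R} (\<lambda>s. exp (- c * s) * deriv v s)
    = - v0 + c * integral {0..R} (\<lambda>s. exp (- c * s) * v s)"
proof -
  have R: "0 < R" "v 0 = v0" "v R = 0" using v by (auto simp: fb_solution_def)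
  obtain v' where cont: "continuous_on {0..R} v" "continuous_on {0..R} v'"
    and "v' 0 = - (c / \<Lambda>) * (1 - v0)" and "v' R = 0"
    and d: "\<forall>\<xi>\<in>{0<..<R}. (v has_real_derivative v' \<xi>) (at \<xi>) \<and>
      (v' has_real_derivative (v \<xi> powr \<alpha> + c * v' \<xi>) / \<Lambda>) (at \<xi>)"
    by (rule fb_solution_system[OF v \<open>0 < \<Lambda>\<close>])
  have "((\<lambda>s. exp (- c * s) * deriv v s - c * (exp (- c * s) * v s)) has_integral
      (exp (- c * R) * v R - exp (- c * 0) * v 0)) {0..R}"
  proof (rule fundamental_theorem_of_calculus_interior)
    show "continuous_on {0..R} (\<lambda>s. exp (- c * s) * v s)" by (intro continuous_intros cont)
    fix s assume s: "s \<in> {0<..<R}"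
    then have "(v has_real_derivative deriv v s) (at s)" using d DERIV_imp_deriv by fastforce
    then have "((\<lambda>s. exp (- c * s) * v s) has_real_derivative
        exp (- c * s) * deriv v s - c * (exp (- c * s) * v s)) (at s)"
      by (auto intro!: derivative_eq_intros)
    then show "((\<lambda>s. exp (- c * s) * v s) has_vector_derivative
        exp (- c * s) * deriv v s - c * (exp (- c * s) * v s)) (at s)"
      by (simp add: has_real_derivative_iff_has_vector_derivative)
  qed (use R in simp)
  from has_integral_add[OF this has_integral_mult_right[OF integrable_integral[OF int], of c]]
  show ?thesis using R by (simp add: integral_unique)
qed

theorem theorem7p5:
  fixes \<alpha> \<theta> \<Lambda> :: real
  assumes "0 < \<alpha>" and "\<alpha> < 1" and "0 < \<theta>" and "\<theta> < 1" and "1 < \<Lambda>"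
  shows "\<exists>v0 \<in> {(1 - \<theta>) / \<Lambda> .. 1 - \<theta> / \<Lambda>}.
           Psi \<alpha> \<theta> \<Lambda> v0 = v0 \<and>
           fb_v \<alpha> \<Lambda> v0 0 = v0 \<and>
           integro_differential_system \<alpha> \<theta> \<Lambda> (fb_c \<alpha> \<Lambda> v0) (fb_R \<alpha> \<Lambda> v0) (fb_v \<alpha> \<Lambda> v0)"
proof -
  obtain w w' where "profile \<alpha> w w'" using profile_exists assms by blast
  then interpret profile \<alpha> w w' .
  obtain T where T: "0 < T" and fixed: "\<Lambda> * height T = 1 - \<theta> + (\<Lambda> - 1) * weight \<Lambda> T"
    using fixed_height assms(3-5) by blast
  have \<Lambda>: "0 < \<Lambda>" using assms by simp
  define v0 c R v where "v0 = height T" and "c = speed \<Lambda> T" and "R = len \<Lambda> T" and "v = front \<Lambda> T"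
  have fb: "fb_c \<alpha> \<Lambda> v0 = c" "fb_R \<alpha> \<Lambda> v0 = R" "fb_v \<alpha> \<Lambda> v0 = v"
    using fb_triple_eq[OF \<Lambda> T] by (simp_all add: fb_c_def fb_R_def fb_v_def v0_def c_def R_def v_def)
  have sol: "fb_solution \<alpha> \<Lambda> v0 c R v"
    using fb_solution_front[OF \<Lambda> T] by (simp add: v0_def c_def R_def v_def)
  then have v_0: "v 0 = v0" by (simp add: fb_solution_def)
  note int = speed_times_integral_front[OF \<Lambda> T, folded c_def R_def v_def]
  have weight: "0 \<le> (\<Lambda> - 1) * weight \<Lambda> T" "(\<Lambda> - 1) * weight \<Lambda> T \<le> (\<Lambda> - 1) * 1"
    using assms weight_bounds[OF \<Lambda> T] by (auto intro!: mult_left_mono mult_nonneg_nonneg)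
  \<comment> \<open>The bounds on \<open>weight\<close> confine \<open>v0\<close> to
    \<open>I\<close>, where the projection is the identity.\<close>
  have range: "v0 \<in> {(1 - \<theta>) / \<Lambda> .. 1 - \<theta> / \<Lambda>}"
    using weight fixed \<Lambda> by (simp add: v0_def field_simps)
  have "1 / \<Lambda> * (1 - \<theta> - c * (1 - \<Lambda>) * integral {0..R} (\<lambda>s. exp (- c * s) * v s))
      = 1 / \<Lambda> * (1 - \<theta> + (\<Lambda> - 1) * (c * integral {0..R} (\<lambda>s. exp (- c * s) * v s)))"
    by (simp add: algebra_simps)
  also have "\<dots> = v0" unfolding int(2) fixed[symmetric] using \<Lambda> by (simp add: v0_def)
  finally have "Psi \<alpha> \<theta> \<Lambda> v0 = v0"
    using range unfolding Psi_def fb by (auto simp: proj_interval_def)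
  \<comment> \<open>The integral condition in terms of \<open>weight\<close>: by parts, the integral
    in it is \<open>- v0 + weight \<Lambda> T\<close>.\<close>
  moreover have "\<theta> + v0 = 1 - (1 - \<Lambda>) * (- v0 + weight \<Lambda> T)"
    using fixed by (simp add: v0_def algebra_simps)
  then have "integro_differential_system \<alpha> \<theta> \<Lambda> c R v"
    using sol height_bounds[OF T]
    unfolding integro_differential_system_def v_0 int(2)
      integral_exp_deriv_by_parts[OF sol \<Lambda> int(1)] by (simp add: v0_def)
  ultimately show ?thesis using range v_0 by (intro bexI[of _ v0]) (simp_all add: fb)
qed

end
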